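(* Let $\mathbb{G}$ be a stratified Lie group of step $s$, let $\theta\in[1,\infty]$, and let $\mathbf b=\sum_{i=1}^s\sum_{\alpha=1}^{n_i}b^i_\alpha X^i_\alpha$ be a vector field such that $b^i_\alpha\in W^{1,\theta}_{\mathcal H,\mathrm{loc}}(\mathbb G)$ for all $i,\alpha$ and $[\mathbf b,V_1]_p\subseteq\mathcal H_p$ for a.e. $p\in\mathbb G$. Then $$X^j_\beta b^k_\gamma=\sum_{\alpha=1}^{n_{k-j}}c(k-j,j)^\gamma_{\alpha\beta}\,b^{k-j}_\alpha$$ for every $j=1,\dots,s-1$, $\beta=1,\dots,n_j$, $k=j+1,\dots,s$ and $\gamma=1,\dots,n_k$, where the derivatives are weak derivatives and $c(i,j)^\gamma_{\alpha\beta}$ are the structural constants of the Lie algebra.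
   Context: $\mathbb{G}$ is a connected, simply connected Lie group whose Lie algebra $\mathfrak g$ of left-invariant vector fields has a stratification $\mathfrak g=V_1\oplus\dots\oplus V_s$ with nontrivial $V_i$, $V_{i+1}=[V_1,V_i]$ for $i=1,\dots,s-1$, and $[V_1,V_s]=\{0\}$. Put $n_i=\dim V_i$ and fix a basis $X^i_1,\dots,X^i_{n_i}$ of $V_i$ for each $i$. $\mathbb G$ is identified with $\mathbb R^n$ through graded exponential coordinates; the Haar measure $dp$ is Lebesgue measure. The horizontal distribution is $\mathcal H_p=V_1(p)$. The structural constants are defined by $[X^i_\alpha,X^j_\beta]=\sum_{\gamma=1}^{n_{i+j}}c(i,j)^\gamma_{\alpha\beta}X^{i+j}_\gamma$ for $i+j\le s$. Weak derivatives are given by $\langle X^i_\alpha u,\varphi\rangle=-\int uX^i_\alpha\varphi\,dp$, $\varphi\in C_c^\infty$. $W^{1,\theta}_{\mathcal H}(\Omega)$ is the set of $u\in L^\theta(\Omega)$ with $X^1_\alpha u\in L^\theta(\Omega)$ for $\alpha=1,\dots,n_1$; $\mathrm{loc}$ denotes the local version. The condition $[\mathbf b,V_1]_p\subseteq\mathcal H_p$ for a.e. $p$ means that for every $Z\in V_1$ one has $[\mathbf b,Z]_p\in\mathcal H_p$ for a.e. $p$, where $[\mathbf b,Z]=\sum_{i,\alpha}b^i_\alpha[X^i_\alpha,Z]-\sum_{i,\alpha}(Zb^i_\alpha)X^i_\alpha$ with $Zb^i_\alpha$ the weak derivative. *)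

theory Defs
  imports "HOL-Analysis.Analysis" "HOL-Library.Function_Algebras"
begin

section \<open>Smooth maps and vector fields on a Euclidean space\<close>

text \<open>
  In finite dimension, \<open>C\<^sup>k\<^sup>+\<^sup>1\<close> means differentiable with all directional derivatives \<open>C\<^sup>k\<close>.
\<close>

primrec Ck :: "nat \<Rightarrow> ('a::euclidean_space \<Rightarrow> 'b::real_normed_vector) \<Rightarrow> bool" where
  "Ck 0 f \<longleftrightarrow> continuous_on UNIV f"
| "Ck (Suc k) f \<longleftrightarrow>
     (\<forall>x. f differentiable (at x)) \<and> (\<forall>v. Ck k (\<lambda>x. frechet_derivative f (at x) v))"

definition smooth :: "('a::euclidean_space \<Rightarrow> 'b::real_normed_vector) \<Rightarrow> bool" where
  "smooth f \<longleftrightarrow> (\<forall>k. Ck k f)"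

text \<open>
  A vector field on the Euclidean space \<open>'a\<close> is a map \<open>'a \<Rightarrow> 'a\<close>. Zero and addition of vector
  fields are the pointwise operations of \<^theory>\<open>HOL-Library.Function_Algebras\<close>; as there is no
  scalar multiplication on functions, the vector space structure is an interpretation, which
  provides the notions \<open>vf.subspace\<close>, \<open>vf.span\<close> and \<open>vf.independent\<close>.
\<close>

definition vf_scale :: "real \<Rightarrow> ('a \<Rightarrow> 'b::real_vector) \<Rightarrow> 'a \<Rightarrow> 'b" where
  "vf_scale r X = (\<lambda>p. r *\<^sub>R X p)"

interpretation vf: vector_space "vf_scale :: real \<Rightarrow> ('a \<Rightarrow> 'b::real_vector) \<Rightarrow> 'a \<Rightarrow> 'b"
  by unfold_locales (auto simp: vf_scale_def fun_eq_iff algebra_simps)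

definition vf_apply ::
  "('a::euclidean_space \<Rightarrow> 'a) \<Rightarrow> ('a \<Rightarrow> real) \<Rightarrow> 'a \<Rightarrow> real" where
  "vf_apply X f p = frechet_derivative f (at p) (X p)"

text \<open>
  In coordinates the commutator \<open>f \<mapsto> X (Y f) - Y (X f)\<close> has the components \<open>X (Y\<^sub>k) - Y (X\<^sub>k)\<close>.
\<close>

definition lie_bracket ::
  "('a::euclidean_space \<Rightarrow> 'a) \<Rightarrow> ('a \<Rightarrow> 'a) \<Rightarrow> 'a \<Rightarrow> 'a" where
  "lie_bracket X Y p =
     frechet_derivative Y (at p) (X p) - frechet_derivative X (at p) (Y p)"


section \<open>Stratified Lie groups in graded exponential coordinates\<close>

text \<open>
  Lie groups with underlying manifold \<open>'a\<close>; as a Euclidean space, \<open>'a\<close> is connected and simply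
  connected.
\<close>

locale euclidean_lie_group = group gmul gid ginv
  for gmul :: "'a::euclidean_space \<Rightarrow> 'a \<Rightarrow> 'a" and gid :: 'a and ginv :: "'a \<Rightarrow> 'a" +
  assumes smooth_gmul: "smooth (\<lambda>z. gmul (fst z) (snd z))"
    and smooth_ginv: "smooth ginv"

definition left_invariant ::
  "('a::euclidean_space \<Rightarrow> 'a \<Rightarrow> 'a) \<Rightarrow> ('a \<Rightarrow> 'a) \<Rightarrow> bool" where
  "left_invariant gmul X \<longleftrightarrow>
     (\<forall>p q. X (gmul p q) = frechet_derivative (gmul p) (at q) (X q))"

definition lie_algebra :: "('a::euclidean_space \<Rightarrow> 'a \<Rightarrow> 'a) \<Rightarrow> ('a \<Rightarrow> 'a) set" where
  "lie_algebra gmul = {X. smooth X \<and> left_invariant gmul X}"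

definition bracket_space ::
  "('a::euclidean_space \<Rightarrow> 'a) set \<Rightarrow> ('a \<Rightarrow> 'a) set \<Rightarrow> ('a \<Rightarrow> 'a) set" where
  "bracket_space A B = vf.span {lie_bracket X Y | X Y. X \<in> A \<and> Y \<in> B}"

text \<open>\<open>is_exp gid X p\<close> says that \<open>p = exp X\<close>, i.e. \<open>p\<close> is the time-one point of the integral curve
  of \<open>X\<close> issuing from the identity.\<close>

definition is_exp :: "'a::euclidean_space \<Rightarrow> ('a \<Rightarrow> 'a) \<Rightarrow> 'a \<Rightarrow> bool" where
  "is_exp gid X p \<longleftrightarrow>
     (\<exists>\<gamma> :: real \<Rightarrow> 'a. \<gamma> 0 = gid \<and> \<gamma> 1 = p \<and>
        (\<forall>t. (\<gamma> has_vector_derivative X (\<gamma> t)) (at t)))"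

text \<open>\<open>V i\<close> is only relevant for \<open>i \<in> {1..s}\<close>.\<close>

locale stratified_lie_group = euclidean_lie_group gmul gid ginv
  for gmul :: "'a::euclidean_space \<Rightarrow> 'a \<Rightarrow> 'a" and gid :: 'a and ginv :: "'a \<Rightarrow> 'a" +
  fixes s :: nat
    and V :: "nat \<Rightarrow> ('a \<Rightarrow> 'a) set"
  assumes step_pos: "1 \<le> s"
    and V_subspace: "\<And>i. i \<in> {1..s} \<Longrightarrow> vf.subspace (V i)"
    and V_subset: "\<And>i. i \<in> {1..s} \<Longrightarrow> V i \<subseteq> lie_algebra gmul"
    and V_nontrivial: "\<And>i. i \<in> {1..s} \<Longrightarrow> V i \<noteq> {0}"
    and direct_sum:
      "\<And>X. X \<in> lie_algebra gmul \<Longrightarrow> \<exists>!v. v \<in> Pi\<^sub>E {1..s} V \<and> X = (\<Sum>i=1..s. v i)"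
    and V_generated: "\<And>i. i \<in> {1..<s} \<Longrightarrow> V (i + 1) = bracket_space (V 1) (V i)"
    and V_last: "bracket_space (V 1) (V s) = {0}"

text \<open>
  \<open>X i \<alpha>\<close>, \<open>1 \<le> \<alpha> \<le> n i\<close>, is a basis of \<open>V i\<close>. The standard coordinates of \<open>'a\<close>, enumerated by
  \<open>e i \<alpha>\<close> with the same index set, are the associated exponential coordinates of the first kind;
  in these coordinates the Haar measure is Lebesgue measure.
\<close>

locale graded_exp_coordinates = stratified_lie_group gmul gid ginv s V
  for gmul :: "'a::euclidean_space \<Rightarrow> 'a \<Rightarrow> 'a" and gid :: 'a and ginv :: "'a \<Rightarrow> 'a"
    and s :: nat and V :: "nat \<Rightarrow> ('a \<Rightarrow> 'a) set" +
  fixes n :: "nat \<Rightarrow> nat"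
    and X :: "nat \<Rightarrow> nat \<Rightarrow> 'a \<Rightarrow> 'a"
    and e :: "nat \<Rightarrow> nat \<Rightarrow> 'a"
  assumes X_inj: "\<And>i. i \<in> {1..s} \<Longrightarrow> inj_on (X i) {1..n i}"
    and X_independent: "\<And>i. i \<in> {1..s} \<Longrightarrow> vf.independent (X i ` {1..n i})"
    and X_span: "\<And>i. i \<in> {1..s} \<Longrightarrow> vf.span (X i ` {1..n i}) = V i"
    and e_bij: "bij_betw (\<lambda>(i, \<alpha>). e i \<alpha>) (SIGMA i:{1..s}. {1..n i}) Basis"
    and exp_coordinates:
      "\<And>x. is_exp gid (\<Sum>i=1..s. \<Sum>\<alpha>=1..n i. vf_scale (x \<bullet> e i \<alpha>) (X i \<alpha>)) x"

definition horizontal :: "(nat \<Rightarrow> ('a \<Rightarrow> 'a) set) \<Rightarrow> 'a \<Rightarrow> 'a set" where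
  "horizontal V p = {Z p | Z. Z \<in> V 1}"

text \<open>\<open>c i j \<alpha> \<beta> \<gamma>\<close> stands for \<open>c(i,j)\<^sup>\<gamma>\<^sub>\<alpha>\<^sub>\<beta>\<close>.\<close>

definition structural_constants ::
  "nat \<Rightarrow> (nat \<Rightarrow> nat) \<Rightarrow> (nat \<Rightarrow> nat \<Rightarrow> 'a::euclidean_space \<Rightarrow> 'a) \<Rightarrow>
   (nat \<Rightarrow> nat \<Rightarrow> nat \<Rightarrow> nat \<Rightarrow> nat \<Rightarrow> real) \<Rightarrow> bool" where
  "structural_constants s n X c \<longleftrightarrow>
     (\<forall>i\<ge>1. \<forall>j\<ge>1. i + j \<le> s \<longrightarrow> (\<forall>\<alpha>\<in>{1..n i}. \<forall>\<beta>\<in>{1..n j}.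
        lie_bracket (X i \<alpha>) (X j \<beta>) =
          (\<Sum>\<gamma>=1..n (i + j). vf_scale (c i j \<alpha> \<beta> \<gamma>) (X (i + j) \<gamma>))))"


section \<open>Weak derivatives and horizontal Sobolev spaces\<close>

definition test_function :: "'a set \<Rightarrow> ('a::euclidean_space \<Rightarrow> real) \<Rightarrow> bool" where
  "test_function \<Omega> \<phi> \<longleftrightarrow>
     smooth \<phi> \<and> compact (closure {x. \<phi> x \<noteq> 0}) \<and> closure {x. \<phi> x \<noteq> 0} \<subseteq> \<Omega>"

definition locally_integrable :: "'a set \<Rightarrow> ('a::euclidean_space \<Rightarrow> real) \<Rightarrow> bool" where
  "locally_integrable \<Omega> u \<longleftrightarrow> (\<forall>K. compact K \<and> K \<subseteq> \<Omega> \<longrightarrow> integrable (lebesgue_on K) u)"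

text \<open>The distribution \<open>Z u\<close> on \<open>\<Omega>\<close> is represented by the locally integrable function \<open>v\<close>.
  There is no divergence term because \<open>Z\<close> is to be left-invariant.\<close>

definition has_weak_derivative ::
  "'a set \<Rightarrow> ('a::euclidean_space \<Rightarrow> 'a) \<Rightarrow> ('a \<Rightarrow> real) \<Rightarrow> ('a \<Rightarrow> real) \<Rightarrow> bool" where
  "has_weak_derivative \<Omega> Z u v \<longleftrightarrow>
     locally_integrable \<Omega> u \<and> locally_integrable \<Omega> v \<and>
     (\<forall>\<phi>. test_function \<Omega> \<phi> \<longrightarrow>
        (\<integral>p. v p * \<phi> p \<partial>lebesgue_on \<Omega>) = - (\<integral>p. u p * vf_apply Z \<phi> p \<partial>lebesgue_on \<Omega>))"

definition in_Lp :: "ennreal \<Rightarrow> 'a set \<Rightarrow> ('a::euclidean_space \<Rightarrow> real) \<Rightarrow> bool" where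
  "in_Lp \<theta> \<Omega> u \<longleftrightarrow>
     u \<in> borel_measurable (lebesgue_on \<Omega>) \<and>
     (if \<theta> = \<infinity> then \<exists>C. AE p in lebesgue_on \<Omega>. \<bar>u p\<bar> \<le> C
      else integrable (lebesgue_on \<Omega>) (\<lambda>p. \<bar>u p\<bar> powr enn2real \<theta>))"

definition in_W1H ::
  "(nat \<Rightarrow> nat) \<Rightarrow> (nat \<Rightarrow> nat \<Rightarrow> 'a \<Rightarrow> 'a) \<Rightarrow> ennreal \<Rightarrow> 'a set \<Rightarrow>
   ('a::euclidean_space \<Rightarrow> real) \<Rightarrow> bool" where
  "in_W1H n X \<theta> \<Omega> u \<longleftrightarrow>
     in_Lp \<theta> \<Omega> u \<and>
     (\<forall>\<alpha>\<in>{1..n 1}. \<exists>v. has_weak_derivative \<Omega> (X 1 \<alpha>) u v \<and> in_Lp \<theta> \<Omega> v)"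

definition in_W1H_loc ::
  "(nat \<Rightarrow> nat) \<Rightarrow> (nat \<Rightarrow> nat \<Rightarrow> 'a \<Rightarrow> 'a) \<Rightarrow> ennreal \<Rightarrow> 'a set \<Rightarrow>
   ('a::euclidean_space \<Rightarrow> real) \<Rightarrow> bool" where
  "in_W1H_loc n X \<theta> \<Omega> u \<longleftrightarrow>
     (\<forall>U. open U \<and> compact (closure U) \<and> closure U \<subseteq> \<Omega> \<longrightarrow> in_W1H n X \<theta> U u)"

text \<open>\<open>B\<close> is a representative of \<open>[b, Z]\<close> for \<open>b = \<Sum>\<^sub>i\<^sub>\<alpha> b i \<alpha> X i \<alpha>\<close>: weak derivatives, hence \<open>B\<close>, are
  determined only almost everywhere.\<close>

definition is_weak_bracket ::
  "nat \<Rightarrow> (nat \<Rightarrow> nat) \<Rightarrow> (nat \<Rightarrow> nat \<Rightarrow> 'a::euclidean_space \<Rightarrow> 'a) \<Rightarrow>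
   (nat \<Rightarrow> nat \<Rightarrow> 'a \<Rightarrow> real) \<Rightarrow> ('a \<Rightarrow> 'a) \<Rightarrow> ('a \<Rightarrow> 'a) \<Rightarrow> bool" where
  "is_weak_bracket s n X b Z B \<longleftrightarrow>
     (\<exists>Zb. (\<forall>i\<in>{1..s}. \<forall>\<alpha>\<in>{1..n i}. has_weak_derivative UNIV Z (b i \<alpha>) (Zb i \<alpha>)) \<and>
        B = (\<lambda>p. (\<Sum>i=1..s. \<Sum>\<alpha>=1..n i. b i \<alpha> p *\<^sub>R lie_bracket (X i \<alpha>) Z p)
               - (\<Sum>i=1..s. \<Sum>\<alpha>=1..n i. Zb i \<alpha> p *\<^sub>R X i \<alpha> p)))"

end

theory Submission
  imports Defs
begin

text \<open>
  Let \<open>b\<close> also denote the field \<open>\<Sum>\<^sub>k\<^sub>\<gamma> b k \<gamma> X k \<gamma>\<close>. For a field \<open>Y\<close> in \<open>V j\<close>, the component of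
  \<open>[b, Y]\<close> along \<open>X k \<gamma>\<close> with \<open>k > j\<close> is the coefficient of \<open>\<Sum>\<^sub>\<alpha> b (k - j) \<alpha> [X (k - j) \<alpha>, Y]\<close>
  minus the derivative of \<open>b k \<gamma>\<close> along \<open>Y\<close>. The formula to be proved therefore says that bracketing
  with \<open>b\<close> respects the filtration: \<open>[b, V j] \<subseteq> V 1 + \<dots> + V j\<close> for every \<open>j < s\<close>. The hypothesis is
  the case \<open>j = 1\<close>, and the general case follows because \<open>V 1\<close> generates the Lie algebra and \<open>[b, _]\<close>
  is formally a derivation, so that \<open>[b, [A, Y]] = [[b, A], Y] + [A, [b, Y]]\<close>.

  Some care is needed because the coefficients of \<open>b\<close> only have weak derivatives. If \<open>A\<close> and \<open>Y\<close>
  respect the filtration, the derivative of \<open>b k \<gamma>\<close> along \<open>A\<close> is a combination with constant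
  coefficients of the functions \<open>b m \<delta>\<close> with smaller \<open>m\<close>, which can again be differentiated along
  \<open>Y\<close> as long as \<open>k\<close> is larger than the sum of the two degrees. So both mixed weak derivatives exist,
  their difference is the weak derivative along \<open>[A, Y]\<close> (\<open>has_weak_derivative_lie_bracket\<close>), and
  the Jacobi identity (\<open>lie_bracket_Jacobi\<close>) identifies the constants. This closure under brackets is
  \<open>bracket_filtered_lie_bracket\<close>, and \<open>bracket_filtered_all\<close> carries out the induction on \<open>j\<close>.

  The start of the induction, \<open>bracket_filtered_horizontal\<close>, compares components pointwise almost
  everywhere: a combination of left-invariant fields that vanishes at one point vanishes everywhere,
  so the values of the frame at a point are linearly independent (\<open>graded_components_zero\<close>).
\<close>

section \<open>Smooth functions and the symmetry of second derivatives\<close>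

lemma Ck_Suc_imp_Ck: "Ck (Suc k) f \<Longrightarrow> Ck k f"
proof (induction k arbitrary: f)
  case 0
  then show ?case
    by (auto intro!: differentiable_imp_continuous_on simp: differentiable_on_def
        intro: differentiable_at_withinI)
next
  case (Suc k)
  then show ?case by (metis Ck.simps(2))
qed

lemma frechet_derivative_eqI: "(f has_derivative D) (at x) \<Longrightarrow> frechet_derivative f (at x) = D"
  using frechet_derivative_at by metis

text \<open>Lets derivatives be read off from the standard differentiation rules.\<close>
lemma Ck_SucI:
  assumes "\<And>x. (f has_derivative f' x) (at x)" and "\<And>v. Ck k (\<lambda>x. f' x v)"
  shows "Ck (Suc k) f"
proof -
  have "frechet_derivative f (at x) = f' x" for x
    by (rule frechet_derivative_eqI[OF assms(1)])
  then show ?thesis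
    using assms by (auto simp: differentiable_def)
qed

lemma Ck_const: "Ck k (\<lambda>x. c)"
proof (induction k arbitrary: c)
  case (Suc k)
  show ?case by (rule Ck_SucI[where f' = "\<lambda>_ _. 0"]) (auto simp: Suc)
qed auto

lemma Ck_SucD:
  assumes "Ck (Suc k) f"
  shows "(f has_derivative frechet_derivative f (at x)) (at x)"
    and "Ck k (\<lambda>x. frechet_derivative f (at x) v)" and "Ck k f"
  using assms Ck_Suc_imp_Ck[OF assms] by (auto simp: frechet_derivative_works)

lemma Ck_add: "Ck k f \<Longrightarrow> Ck k g \<Longrightarrow> Ck k (\<lambda>x. f x + g x)"
proof (induction k arbitrary: f g)
  case 0
  then show ?case by (auto intro: continuous_on_add)
next
  case (Suc k)
  note f = Ck_SucD[OF Suc.prems(1)] and g = Ck_SucD[OF Suc.prems(2)]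
  show ?case
    by (rule Ck_SucI[OF has_derivative_add[OF f(1) g(1)]]) (intro Suc.IH f g)
qed

lemma Ck_sum: "(\<And>i. i \<in> I \<Longrightarrow> Ck k (f i)) \<Longrightarrow> Ck k (\<lambda>x. \<Sum>i\<in>I. f i x)"
  by (induction I rule: infinite_finite_induct) (auto intro: Ck_const Ck_add)

lemma Ck_bilinear:
  assumes "bounded_bilinear B"
  shows "Ck k f \<Longrightarrow> Ck k g \<Longrightarrow> Ck k (\<lambda>x. B (f x) (g x))"
proof (induction k arbitrary: f g)
  case 0
  then show ?case by (auto intro: bounded_bilinear.continuous_on[OF assms])
next
  case (Suc k)
  note f = Ck_SucD[OF Suc.prems(1)] and g = Ck_SucD[OF Suc.prems(2)]
  show ?case
    by (rule Ck_SucI[OF bounded_bilinear.FDERIV[OF assms f(1) g(1)]])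
      (intro Ck_add Suc.IH f g)
qed

lemma Ck_bounded_linear:
  assumes "bounded_linear h"
  shows "Ck k f \<Longrightarrow> Ck k (\<lambda>x. h (f x))"
proof (induction k arbitrary: f)
  case 0
  then show ?case by (auto intro: bounded_linear.continuous_on[OF assms])
next
  case (Suc k)
  note f = Ck_SucD[OF Suc.prems(1)]
  show ?case
    by (rule Ck_SucI[OF bounded_linear.has_derivative[OF assms f(1)]]) (intro Suc.IH f)
qed

lemma smooth_has_derivative:
  "smooth f \<Longrightarrow> (f has_derivative frechet_derivative f (at x)) (at x)"
  unfolding smooth_def using Ck_SucD(1) by blast

lemma smooth_continuous: "smooth f \<Longrightarrow> continuous_on UNIV f"
  unfolding smooth_def using Ck.simps(1) by blast

lemma smooth_linear_frechet: "smooth f \<Longrightarrow> linear (frechet_derivative f (at x))"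
  using smooth_has_derivative has_derivative_linear by blast

lemma smooth_bounded_linear: "bounded_linear h \<Longrightarrow> smooth f \<Longrightarrow> smooth (\<lambda>x. h (f x))"
  unfolding smooth_def using Ck_bounded_linear by blast

lemma smooth_add: "smooth f \<Longrightarrow> smooth g \<Longrightarrow> smooth (\<lambda>x. f x + g x)"
  unfolding smooth_def using Ck_add by blast

lemma smooth_diff:
  assumes "smooth f" "smooth g" shows "smooth (\<lambda>x. f x - g x)"
  using smooth_add[OF assms(1) smooth_bounded_linear[OF _ assms(2), of uminus]]
  by (simp add: bounded_linear_minus bounded_linear_ident)

lemma smooth_frechet: "smooth f \<Longrightarrow> smooth (\<lambda>x. frechet_derivative f (at x) v)"
  unfolding smooth_def using Ck_SucD(2) by blast

lemma smooth_inner_id: "smooth (\<lambda>x. x \<bullet> (v::'a::euclidean_space))"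
proof -
  have "Ck k (\<lambda>x. x)" for k :: nat
  proof (induction k)
    case (Suc k)
    show ?case by (rule Ck_SucI[OF has_derivative_ident]) (rule Ck_const)
  qed auto
  then show ?thesis
    unfolding smooth_def using Ck_bounded_linear[OF bounded_linear_inner_left] by blast
qed

text \<open>
  Smoothness is defined through derivatives in constant directions, so a derivative along a field
  has to be reduced to finitely many of these.
\<close>
lemma frechet_derivative_expand_basis:
  assumes "smooth f"
  shows "frechet_derivative f (at p) v = (\<Sum>i\<in>Basis. (v \<bullet> i) *\<^sub>R frechet_derivative f (at p) i)"
proof -
  interpret linear "frechet_derivative f (at p)" by (rule smooth_linear_frechet[OF assms])
  show ?thesis
    by (subst euclidean_representation[of v, symmetric]) (simp only: sum scale)
qed

lemma smooth_derivative_along: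
  fixes X :: "'a::euclidean_space \<Rightarrow> 'a"
  assumes "smooth X" "smooth f"
  shows "smooth (\<lambda>p. frechet_derivative f (at p) (X p))"
proof -
  have "smooth (\<lambda>p. \<Sum>i\<in>Basis. (X p \<bullet> i) *\<^sub>R frechet_derivative f (at p) i)"
    using smooth_bounded_linear[OF bounded_linear_inner_left assms(1)] smooth_frechet[OF assms(2)]
    unfolding smooth_def by (intro allI Ck_sum Ck_bilinear[OF bounded_bilinear_scaleR]) auto
  then show ?thesis by (simp flip: frechet_derivative_expand_basis[OF assms(2)])
qed

lemma smooth_vf_apply: "smooth X \<Longrightarrow> smooth f \<Longrightarrow> smooth (vf_apply X f)"
  using smooth_derivative_along[of X f] by (simp add: vf_apply_def[abs_def])

lemma smooth_lie_bracket: "smooth X \<Longrightarrow> smooth Y \<Longrightarrow> smooth (lie_bracket X Y)"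
  unfolding lie_bracket_def[abs_def] by (intro smooth_diff smooth_derivative_along)

text \<open>
  The left-hand side is symmetric in \<open>v\<close> and \<open>w\<close>. Applying the mean value theorem first in direction
  \<open>v\<close> and then in direction \<open>w\<close> writes it as a second derivative at a nearby point; the other order
  gives the second derivative in the opposite order.
\<close>
lemma second_difference_mean_value:
  fixes f :: "'a::euclidean_space \<Rightarrow> real"
  assumes f: "smooth f" and h: "0 < h"
  shows "\<exists>a b. 0 < a \<and> a < h \<and> 0 < b \<and> b < h \<and>
    f (x + h *\<^sub>R v + h *\<^sub>R w) - f (x + h *\<^sub>R v) - f (x + h *\<^sub>R w) + f x =
    h * h * frechet_derivative (\<lambda>y. frechet_derivative f (at y) v) (at (x + a *\<^sub>R v + b *\<^sub>R w)) w"
proof -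
  have D: "((\<lambda>t. g (y + t *\<^sub>R u)) has_real_derivative frechet_derivative g (at (y + t *\<^sub>R u)) u) (at t)"
    if g: "smooth g" for g :: "'a \<Rightarrow> real" and y u t
  proof -
    have "((\<lambda>t. g (y + t *\<^sub>R u)) has_derivative
        (\<lambda>r. frechet_derivative g (at (y + t *\<^sub>R u)) (r *\<^sub>R u))) (at t)"
      by (rule has_derivative_compose[of "\<lambda>t. y + t *\<^sub>R u", OF _ smooth_has_derivative[OF g]])
        (auto intro!: derivative_eq_intros)
    moreover have "(\<lambda>r. frechet_derivative g (at (y + t *\<^sub>R u)) (r *\<^sub>R u)) =
        (*) (frechet_derivative g (at (y + t *\<^sub>R u)) u)"
      by (rule ext) (simp add: linear_scale[OF smooth_linear_frechet[OF g]])
    ultimately show ?thesis by (simp add: has_field_derivative_def)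
  qed
  define g where "g = (\<lambda>y. frechet_derivative f (at y) v)"
  have g: "smooth g" unfolding g_def by (rule smooth_frechet[OF f])
  define \<phi> where "\<phi> = (\<lambda>t. f (x + h *\<^sub>R w + t *\<^sub>R v) - f (x + t *\<^sub>R v))"
  have d\<phi>: "(\<phi> has_real_derivative g (x + h *\<^sub>R w + t *\<^sub>R v) - g (x + t *\<^sub>R v)) (at t)" for t
    unfolding \<phi>_def g_def by (intro DERIV_diff D f)
  obtain a where a: "0 < a" "a < h"
    "\<phi> h - \<phi> 0 = (h - 0) * (g (x + h *\<^sub>R w + a *\<^sub>R v) - g (x + a *\<^sub>R v))"
    using MVT2[OF h d\<phi>] by blast
  obtain b where b: "0 < b" "b < h"
    "g (x + a *\<^sub>R v + h *\<^sub>R w) - g (x + a *\<^sub>R v + 0 *\<^sub>R w) =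
       (h - 0) * frechet_derivative g (at (x + a *\<^sub>R v + b *\<^sub>R w)) w"
    using MVT2[OF h D[OF g]] by blast
  have e: "x + h *\<^sub>R w + t *\<^sub>R v = x + t *\<^sub>R v + h *\<^sub>R w" for t
    by (simp add: algebra_simps)
  have "f (x + h *\<^sub>R v + h *\<^sub>R w) - f (x + h *\<^sub>R v) - f (x + h *\<^sub>R w) + f x = \<phi> h - \<phi> 0"
    by (simp add: \<phi>_def e)
  also have "\<dots> = h * h * frechet_derivative g (at (x + a *\<^sub>R v + b *\<^sub>R w)) w"
    using a(3) b(3) by (simp add: e)
  finally show ?thesis using a(1,2) b(1,2) unfolding g_def by blast
qed

text \<open>
  Second difference quotients are symmetric in the two directions and converge to either mixed
  derivative.
\<close>
lemma second_derivative_symmetric: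
  fixes f :: "'a::euclidean_space \<Rightarrow> real"
  assumes f: "smooth f"
  shows "frechet_derivative (\<lambda>y. frechet_derivative f (at y) v) (at x) w =
         frechet_derivative (\<lambda>y. frechet_derivative f (at y) w) (at x) v"
proof -
  define G where "G = (\<lambda>v w y. frechet_derivative (\<lambda>y. frechet_derivative f (at y) v) (at y) w)"
  define h where "h = (\<lambda>m. inverse (real (Suc m)))"
  have h: "h m > 0" for m by (simp add: h_def)
  have h0: "h \<longlonglongrightarrow> 0" unfolding h_def by (rule LIMSEQ_inverse_real_of_nat)
  define Q where "Q = (\<lambda>v w m. (f (x + h m *\<^sub>R v + h m *\<^sub>R w) - f (x + h m *\<^sub>R v)
    - f (x + h m *\<^sub>R w) + f x) / (h m * h m))"
  have lim: "Q v w \<longlonglongrightarrow> G v w x" for v w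
  proof -
    have "\<exists>a b. 0 < a \<and> a < h m \<and> 0 < b \<and> b < h m \<and> Q v w m = G v w (x + a *\<^sub>R v + b *\<^sub>R w)" for m
    proof -
      obtain a b where "0 < a" "a < h m" "0 < b" "b < h m" and
        q: "f (x + h m *\<^sub>R v + h m *\<^sub>R w) - f (x + h m *\<^sub>R v) - f (x + h m *\<^sub>R w) + f x =
          h m * h m * G v w (x + a *\<^sub>R v + b *\<^sub>R w)"
        using second_difference_mean_value[OF f h[of m], of x v w] unfolding G_def by blast
      moreover have "Q v w m = G v w (x + a *\<^sub>R v + b *\<^sub>R w)"
        unfolding Q_def q using h[of m] by simp
      ultimately show ?thesis by blast
    qed
    then obtain a b where ab: "\<And>m. 0 < a m" "\<And>m. a m < h m" "\<And>m. 0 < b m" "\<And>m. b m < h m"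
      "\<And>m. Q v w m = G v w (x + a m *\<^sub>R v + b m *\<^sub>R w)" by metis
    have a0: "a \<longlonglongrightarrow> 0"
      by (rule tendsto_sandwich[OF _ _ tendsto_const h0]) (auto intro!: always_eventually less_imp_le ab)
    have b0: "b \<longlonglongrightarrow> 0"
      by (rule tendsto_sandwich[OF _ _ tendsto_const h0]) (auto intro!: always_eventually less_imp_le ab)
    have "(\<lambda>m. x + a m *\<^sub>R v + b m *\<^sub>R w) \<longlonglongrightarrow> x + 0 *\<^sub>R v + 0 *\<^sub>R w"
      by (intro tendsto_intros a0 b0)
    then have "(\<lambda>m. x + a m *\<^sub>R v + b m *\<^sub>R w) \<longlonglongrightarrow> x" by simp
    moreover have "isCont (G v w) x"
      using smooth_continuous[OF smooth_frechet[OF smooth_frechet[OF f]]]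
      unfolding G_def by (simp add: continuous_on_eq_continuous_at)
    ultimately have "(\<lambda>m. G v w (x + a m *\<^sub>R v + b m *\<^sub>R w)) \<longlonglongrightarrow> G v w x"
      by (rule isCont_tendsto_compose[rotated])
    moreover have "Q v w = (\<lambda>m. G v w (x + a m *\<^sub>R v + b m *\<^sub>R w))"
      by (rule ext) (rule ab(5))
    ultimately show ?thesis by simp
  qed
  have sw: "x + h m *\<^sub>R v + h m *\<^sub>R w = x + h m *\<^sub>R w + h m *\<^sub>R v" for m
    by (simp add: algebra_simps)
  then have "Q v w = Q w v" unfolding Q_def sw by (intro ext arg_cong2[of _ _ _ _ divide] refl) linarith
  then show ?thesis using LIMSEQ_unique[OF lim[of v w]] lim[of w v] unfolding G_def by simp
qed


section \<open>The Lie bracket as a commutator\<close>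

text \<open>
  In coordinates \<open>X (Y f)\<close> consists of the derivative of \<open>f\<close> in direction \<open>X (Y)\<close>, which contributes to
  the bracket, and of the Hessian of \<open>f\<close> at \<open>X\<close> and \<open>Y\<close>, which is symmetric and cancels.
\<close>
lemma vf_apply_lie_bracket:
  fixes X Y :: "'a::euclidean_space \<Rightarrow> 'a"
  assumes X: "smooth X" and Y: "smooth Y" and f: "smooth f"
  shows "vf_apply (lie_bracket X Y) f p = vf_apply X (vf_apply Y f) p - vf_apply Y (vf_apply X f) p"
proof -
  have second: "vf_apply X (vf_apply Y f) p = frechet_derivative f (at p) (frechet_derivative Y (at p) (X p))
     + (\<Sum>i\<in>Basis. \<Sum>j\<in>Basis. (Y p \<bullet> i) * (X p \<bullet> j) *
          frechet_derivative (\<lambda>q. frechet_derivative f (at q) i) (at p) j)"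
    if X: "smooth X" and Y: "smooth Y" for X Y :: "'a \<Rightarrow> 'a"
  proof -
    have e: "vf_apply Y f = (\<lambda>q. \<Sum>i\<in>Basis. (Y q \<bullet> i) * frechet_derivative f (at q) i)"
      unfolding vf_apply_def[abs_def] by (subst frechet_derivative_expand_basis[OF f]) simp
    have "(vf_apply Y f has_derivative (\<lambda>v. \<Sum>i\<in>Basis.
        (Y p \<bullet> i) * frechet_derivative (\<lambda>q. frechet_derivative f (at q) i) (at p) v
        + (frechet_derivative Y (at p) v \<bullet> i) * frechet_derivative f (at p) i)) (at p)"
      unfolding e
      by (intro has_derivative_sum has_derivative_mult has_derivative_inner_left
          smooth_has_derivative smooth_frechet f Y)
    then have "vf_apply X (vf_apply Y f) p = (\<Sum>i\<in>Basis.
        (Y p \<bullet> i) * frechet_derivative (\<lambda>q. frechet_derivative f (at q) i) (at p) (X p)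
        + (frechet_derivative Y (at p) (X p) \<bullet> i) * frechet_derivative f (at p) i)"
      unfolding vf_apply_def[of X] by (simp add: frechet_derivative_eqI)
    also have "\<dots> = (\<Sum>i\<in>Basis. \<Sum>j\<in>Basis. (Y p \<bullet> i) * (X p \<bullet> j) *
          frechet_derivative (\<lambda>q. frechet_derivative f (at q) i) (at p) j)
        + (\<Sum>i\<in>Basis. (frechet_derivative Y (at p) (X p) \<bullet> i) * frechet_derivative f (at p) i)"
      by (subst frechet_derivative_expand_basis[OF smooth_frechet[OF f]])
        (simp add: sum.distrib sum_distrib_left mult.assoc)
    also have "(\<Sum>i\<in>Basis. (frechet_derivative Y (at p) (X p) \<bullet> i) * frechet_derivative f (at p) i)
        = frechet_derivative f (at p) (frechet_derivative Y (at p) (X p))"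
      by (subst (2) frechet_derivative_expand_basis[OF f]) simp
    finally show ?thesis by simp
  qed
  have "(\<Sum>i\<in>Basis. \<Sum>j\<in>Basis. (Y p \<bullet> i) * (X p \<bullet> j) *
          frechet_derivative (\<lambda>q. frechet_derivative f (at q) i) (at p) j)
      = (\<Sum>i\<in>Basis. \<Sum>j\<in>Basis. (X p \<bullet> i) * (Y p \<bullet> j) *
          frechet_derivative (\<lambda>q. frechet_derivative f (at q) i) (at p) j)"
    by (subst sum.swap, intro sum.cong refl, subst second_derivative_symmetric[OF f]) simp
  then show ?thesis
    using second[OF X Y] second[OF Y X] linear_diff[OF smooth_linear_frechet[OF f]]
    by (simp add: vf_apply_def[of "lie_bracket X Y"] lie_bracket_def)
qed

lemma vf_apply_diff:
  assumes "smooth f" "smooth g"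
  shows "vf_apply X (\<lambda>q. f q - g q) p = vf_apply X f p - vf_apply X g p"
  unfolding vf_apply_def
  by (subst frechet_derivative_eqI[OF has_derivative_diff[OF
        smooth_has_derivative[OF assms(1)] smooth_has_derivative[OF assms(2)]]]) simp

text \<open>
  A field is determined by its action on the coordinate functions, and for commutators of operators
  the identity is plain algebra.
\<close>
lemma lie_bracket_Jacobi:
  fixes X Y Z :: "'a::euclidean_space \<Rightarrow> 'a"
  assumes X: "smooth X" and Y: "smooth Y" and Z: "smooth Z"
  shows "lie_bracket X (lie_bracket Y Z) =
    lie_bracket (lie_bracket X Y) Z - lie_bracket (lie_bracket X Z) Y"
proof
  fix p
  have coord: "vf_apply W (\<lambda>q. q \<bullet> i) p = W p \<bullet> i" for W :: "'a \<Rightarrow> 'a" and i p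
    unfolding vf_apply_def
    by (subst frechet_derivative_eqI[OF bounded_linear_imp_has_derivative[OF bounded_linear_inner_left]]) simp
  have XY: "vf_apply (lie_bracket X Y) f = (\<lambda>p. vf_apply X (vf_apply Y f) p - vf_apply Y (vf_apply X f) p)"
    if "smooth X" "smooth Y" "smooth f" for X Y :: "'a \<Rightarrow> 'a" and f
    using vf_apply_lie_bracket[OF that] by blast
  note sm = smooth_inner_id smooth_lie_bracket smooth_vf_apply X Y Z
  show "lie_bracket X (lie_bracket Y Z) p =
    (lie_bracket (lie_bracket X Y) Z - lie_bracket (lie_bracket X Z) Y) p"
  proof (rule euclidean_eqI)
    fix i :: 'a
    show "lie_bracket X (lie_bracket Y Z) p \<bullet> i =
      (lie_bracket (lie_bracket X Y) Z - lie_bracket (lie_bracket X Z) Y) p \<bullet> i"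
      unfolding fun_diff_def inner_diff_left
      unfolding coord[of "lie_bracket _ _", symmetric]
      by (simp add: sm XY vf_apply_diff)
  qed
qed

lemma smooth_vf_linear:
  assumes "smooth X" "smooth Y"
  shows "smooth (vf_scale r X + Y)"
  using smooth_add[OF smooth_bounded_linear[OF bounded_linear_scaleR_right assms(1)] assms(2)]
  by (simp add: vf_scale_def plus_fun_def)

lemma smooth_zero: "smooth 0"
  unfolding smooth_def zero_fun_def by (simp add: Ck_const)

lemma lie_bracket_linear_left:
  assumes "smooth X" "smooth Y" and Z: "smooth Z"
  shows "lie_bracket (vf_scale r X + Y) Z = vf_scale r (lie_bracket X Z) + lie_bracket Y Z"
proof
  fix p
  have "((\<lambda>q. r *\<^sub>R X q + Y q) has_derivative
      (\<lambda>v. r *\<^sub>R frechet_derivative X (at p) v + frechet_derivative Y (at p) v)) (at p)"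
    by (intro has_derivative_add has_derivative_scaleR_right smooth_has_derivative assms)
  moreover have "vf_scale r X + Y = (\<lambda>q. r *\<^sub>R X q + Y q)" by (auto simp: vf_scale_def)
  ultimately have "frechet_derivative (vf_scale r X + Y) (at p) =
      (\<lambda>v. r *\<^sub>R frechet_derivative X (at p) v + frechet_derivative Y (at p) v)"
    by (simp only: frechet_derivative_eqI)
  moreover have "frechet_derivative Z (at p) (r *\<^sub>R X p + Y p) =
      r *\<^sub>R frechet_derivative Z (at p) (X p) + frechet_derivative Z (at p) (Y p)"
    using linear_add[OF smooth_linear_frechet[OF Z]] linear_scale[OF smooth_linear_frechet[OF Z]]
    by simp
  ultimately show "lie_bracket (vf_scale r X + Y) Z p = (vf_scale r (lie_bracket X Z) + lie_bracket Y Z) p"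
    by (simp add: lie_bracket_def vf_scale_def algebra_simps)
qed

lemma lie_bracket_zero_left:
  assumes "smooth Z"
  shows "lie_bracket 0 Z = 0"
  using lie_bracket_linear_left[OF smooth_zero smooth_zero assms, of 1] by simp

lemma lie_bracket_antisym: "lie_bracket X Y = - lie_bracket Y X"
  by (simp add: lie_bracket_def fun_eq_iff)

lemma lie_bracket_linear_right:
  assumes "smooth X" "smooth Y" "smooth Z"
  shows "lie_bracket X (vf_scale r Y + Z) = vf_scale r (lie_bracket X Y) + lie_bracket X Z"
  using lie_bracket_linear_left[OF assms(2,3,1), of r] lie_bracket_antisym[of X]
  by (simp add: fun_eq_iff vf_scale_def)

lemma sum_fun_apply: "(\<Sum>i\<in>I. f i) x = (\<Sum>i\<in>I. f i x)"
  by (induction I rule: infinite_finite_induct) auto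

lemma lie_bracket_sum_left:
  assumes "\<And>i. i \<in> I \<Longrightarrow> smooth (W i)" and Z: "smooth Z"
  shows "lie_bracket (\<Sum>i\<in>I. vf_scale (r i) (W i)) Z = (\<Sum>i\<in>I. vf_scale (r i) (lie_bracket (W i) Z))"
proof -
  have "smooth (\<Sum>i\<in>I. vf_scale (r i) (W i)) \<and>
    lie_bracket (\<Sum>i\<in>I. vf_scale (r i) (W i)) Z = (\<Sum>i\<in>I. vf_scale (r i) (lie_bracket (W i) Z))"
    using assms(1)
  proof (induction I rule: infinite_finite_induct)
    case (insert i I)
    have W: "smooth (W i)" by (rule insert.prems) simp
    have IH: "smooth (\<Sum>i\<in>I. vf_scale (r i) (W i))"
      "lie_bracket (\<Sum>i\<in>I. vf_scale (r i) (W i)) Z = (\<Sum>i\<in>I. vf_scale (r i) (lie_bracket (W i) Z))"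
      using insert.IH[OF insert.prems] by simp_all
    show ?case
      unfolding sum.insert[OF insert.hyps] lie_bracket_linear_left[OF W IH(1) Z] IH(2)
      using smooth_vf_linear[OF W IH(1)] by blast
  qed (simp_all add: smooth_zero lie_bracket_zero_left[OF Z])
  then show ?thesis by blast
qed


section \<open>Calculus of weak derivatives\<close>

lemma vf_apply_linear_field:
  assumes "smooth \<phi>"
  shows "vf_apply (vf_scale r Y + Z) \<phi> p = r * vf_apply Y \<phi> p + vf_apply Z \<phi> p"
    and "vf_apply 0 \<phi> p = 0"
proof -
  interpret linear "frechet_derivative \<phi> (at p)" by (rule smooth_linear_frechet[OF assms])
  show "vf_apply (vf_scale r Y + Z) \<phi> p = r * vf_apply Y \<phi> p + vf_apply Z \<phi> p"
    and "vf_apply 0 \<phi> p = 0"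
    by (simp_all add: vf_apply_def vf_scale_def add scale zero)
qed

lemma zero_outside_support: "x \<notin> closure {x. \<phi> x \<noteq> 0} \<Longrightarrow> \<phi> x = 0"
  using subsetD[OF closure_subset, of x "{x. \<phi> x \<noteq> 0}"] by (cases "\<phi> x = 0") simp_all

lemma test_function_vf_apply:
  assumes "test_function UNIV \<phi>" and Z: "smooth Z"
  shows "test_function UNIV (vf_apply Z \<phi>)"
proof -
  define K where "K = closure {x. \<phi> x \<noteq> 0}"
  have \<phi>: "smooth \<phi>" and K: "compact K" using assms(1) by (auto simp: test_function_def K_def)
  have out: "\<phi> x = 0" if "x \<notin> K" for x
    using that unfolding K_def by (rule zero_outside_support)
  have out': "vf_apply Z \<phi> x = 0" if "x \<notin> K" for x
  proof -
    have "((\<lambda>_. 0) has_derivative (\<lambda>_. 0)) (at x)" by simp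
    then have "(\<phi> has_derivative (\<lambda>_. 0)) (at x)"
    proof (rule has_derivative_transform_within_open[where s = "- K"])
      show "open (- K)" by (simp add: K_def open_Compl)
    qed (use that in \<open>simp_all add: out\<close>)
    from frechet_derivative_eqI[OF this] show ?thesis by (simp add: vf_apply_def)
  qed
  have "closure {x. vf_apply Z \<phi> x \<noteq> 0} \<subseteq> K"
  proof (rule closure_minimal)
    show "{x. vf_apply Z \<phi> x \<noteq> 0} \<subseteq> K" using out' by blast
    show "closed K" by (simp add: K_def)
  qed
  then have "compact (closure {x. vf_apply Z \<phi> x \<noteq> 0})"
    using compact_Int_closed[OF K closed_closure] by (metis inf_absorb2)
  then show ?thesis
    using smooth_vf_apply[OF Z \<phi>] by (simp add: test_function_def)
qed

text \<open>On the compact support of \<open>\<phi>\<close>, \<open>u\<close> is integrable and \<open>\<phi>\<close> is bounded.\<close>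
lemma integrable_locally_integrable_mult_test:
  fixes u :: "'a::euclidean_space \<Rightarrow> real"
  assumes u: "locally_integrable UNIV u" and \<phi>: "test_function UNIV \<phi>"
  shows "integrable lebesgue (\<lambda>p. u p * \<phi> p)"
proof -
  define K where "K = closure {x. \<phi> x \<noteq> 0}"
  have K: "compact K" and sm: "smooth \<phi>" using \<phi> by (auto simp: test_function_def K_def)
  have Ks: "K \<in> sets lebesgue" using K by (simp add: lmeasurable_compact fmeasurableD)
  have cont: "continuous_on K \<phi>" using smooth_continuous[OF sm] continuous_on_subset by blast
  have "u absolutely_integrable_on K"
    using u K Ks by (auto simp: locally_integrable_def set_integrable_def integrable_restrict_space)
  then have "(\<lambda>p. \<phi> p * u p) absolutely_integrable_on K"
    by (rule absolutely_integrable_bounded_measurable_product[OF bilinear_times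
          continuous_imp_measurable_on_sets_lebesgue[OF cont Ks] Ks
          compact_imp_bounded[OF compact_continuous_image[OF cont K]]])
  moreover have eq: "indicator K p *\<^sub>R (\<phi> p * u p) = u p * \<phi> p" for p
  proof (cases "p \<in> K")
    case False
    then have "\<phi> p = 0" unfolding K_def by (rule zero_outside_support)
    then show ?thesis by simp
  qed simp
  ultimately show ?thesis unfolding set_integrable_def eq by blast
qed

lemma locally_integrable_linear:
  "locally_integrable \<Omega> u \<Longrightarrow> locally_integrable \<Omega> v \<Longrightarrow> locally_integrable \<Omega> (\<lambda>p. r * u p + v p)"
  "locally_integrable \<Omega> (\<lambda>p. 0)"
  by (auto simp: locally_integrable_def)

lemma has_weak_derivative_UNIV:
  "has_weak_derivative UNIV Z u v \<longleftrightarrow>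
     locally_integrable UNIV u \<and> locally_integrable UNIV v \<and>
     (\<forall>\<phi>. test_function UNIV \<phi> \<longrightarrow>
        (\<integral>p. v p * \<phi> p \<partial>lebesgue) = - (\<integral>p. u p * vf_apply Z \<phi> p \<partial>lebesgue))"
  by (simp add: has_weak_derivative_def lebesgue_on_UNIV_eq)

lemma has_weak_derivative_linear:
  assumes Z: "smooth Z" and u: "has_weak_derivative UNIV Z u u'" and v: "has_weak_derivative UNIV Z v v'"
  shows "has_weak_derivative UNIV Z (\<lambda>p. r * u p + v p) (\<lambda>p. r * u' p + v' p)"
  unfolding has_weak_derivative_UNIV
proof (intro conjI allI impI)
  fix \<phi> :: "'a \<Rightarrow> real" assume \<phi>: "test_function UNIV \<phi>"
  note int = integrable_locally_integrable_mult_test[OF _ \<phi>]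
    integrable_locally_integrable_mult_test[OF _ test_function_vf_apply[OF \<phi> Z]]
  show "(\<integral>p. (r * u' p + v' p) * \<phi> p \<partial>lebesgue) =
      - (\<integral>p. (r * u p + v p) * vf_apply Z \<phi> p \<partial>lebesgue)"
    using u v \<phi> int by (simp add: has_weak_derivative_UNIV distrib_right mult.assoc)
qed (use u v in \<open>auto simp: has_weak_derivative_UNIV intro: locally_integrable_linear\<close>)

lemma has_weak_derivative_sum:
  assumes "smooth Z" and "\<And>i. i \<in> I \<Longrightarrow> has_weak_derivative UNIV Z (u i) (u' i)"
  shows "has_weak_derivative UNIV Z (\<lambda>p. \<Sum>i\<in>I. r i * u i p) (\<lambda>p. \<Sum>i\<in>I. r i * u' i p)"
  using assms(2)
proof (induction I rule: infinite_finite_induct)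
  case (insert i I)
  then show ?case by (simp add: has_weak_derivative_linear[OF assms(1)])
qed (auto simp: has_weak_derivative_UNIV locally_integrable_linear)

lemma has_weak_derivative_linear_field:
  assumes "smooth Y" "smooth Z"
    and Y: "has_weak_derivative UNIV Y u v" and Z: "has_weak_derivative UNIV Z u w"
  shows "has_weak_derivative UNIV (vf_scale r Y + Z) u (\<lambda>p. r * v p + w p)"
  unfolding has_weak_derivative_UNIV
proof (intro conjI allI impI)
  fix \<phi> :: "'a \<Rightarrow> real" assume \<phi>: "test_function UNIV \<phi>"
  note int = integrable_locally_integrable_mult_test[OF _ \<phi>]
    integrable_locally_integrable_mult_test[OF _ test_function_vf_apply[OF \<phi> assms(1)]]
    integrable_locally_integrable_mult_test[OF _ test_function_vf_apply[OF \<phi> assms(2)]]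
  have "smooth \<phi>" using \<phi> by (simp add: test_function_def)
  then show "(\<integral>p. (r * v p + w p) * \<phi> p \<partial>lebesgue) =
      - (\<integral>p. u p * vf_apply (vf_scale r Y + Z) \<phi> p \<partial>lebesgue)"
    using Y Z \<phi> int
    by (simp add: has_weak_derivative_UNIV distrib_left distrib_right mult.assoc
        mult.left_commute[of _ r] vf_apply_linear_field)
qed (use Y Z in \<open>auto simp: has_weak_derivative_UNIV intro: locally_integrable_linear\<close>)

lemma has_weak_derivative_zero_field:
  "locally_integrable UNIV u \<Longrightarrow> has_weak_derivative UNIV 0 u (\<lambda>p. 0)"
  by (auto simp: has_weak_derivative_UNIV locally_integrable_linear vf_apply_linear_field test_function_def)

lemma has_weak_derivative_AE_cong:
  assumes v: "has_weak_derivative UNIV Z u v" and w: "locally_integrable UNIV w"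
    and AE: "AE p in lebesgue. v p = w p"
  shows "has_weak_derivative UNIV Z u w"
  unfolding has_weak_derivative_UNIV
proof (intro conjI allI impI)
  fix \<phi> :: "'a \<Rightarrow> real" assume \<phi>: "test_function UNIV \<phi>"
  have "(\<integral>p. w p * \<phi> p \<partial>lebesgue) = (\<integral>p. v p * \<phi> p \<partial>lebesgue)"
    using AE v w integrable_locally_integrable_mult_test[OF _ \<phi>]
    by (intro integral_cong_AE borel_measurable_integrable) (auto simp: has_weak_derivative_UNIV)
  then show "(\<integral>p. w p * \<phi> p \<partial>lebesgue) = - (\<integral>p. u p * vf_apply Z \<phi> p \<partial>lebesgue)"
    using v \<phi> by (simp add: has_weak_derivative_UNIV)
qed (use v w in \<open>auto simp: has_weak_derivative_UNIV\<close>)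

text \<open>
  By the commutator identity it suffices to move the derivatives in \<open>Z (Y \<phi>)\<close> and \<open>Y (Z \<phi>)\<close> to \<open>u\<close>
  one at a time, \<open>Y \<phi>\<close> and \<open>Z \<phi>\<close> being test functions themselves. Each integration by parts reverses
  the order of the operators.
\<close>
lemma has_weak_derivative_lie_bracket:
  assumes sm: "smooth Y" "smooth Z"
    and Yu: "has_weak_derivative UNIV Y u v" and Zu: "has_weak_derivative UNIV Z u w"
    and ZYu: "has_weak_derivative UNIV Z v v'" and YZu: "has_weak_derivative UNIV Y w w'"
  shows "has_weak_derivative UNIV (lie_bracket Y Z) u (\<lambda>p. w' p - v' p)"
  unfolding has_weak_derivative_UNIV
proof (intro conjI allI impI)
  fix \<phi> :: "'a \<Rightarrow> real" assume \<phi>: "test_function UNIV \<phi>"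
  note \<phi>Y = test_function_vf_apply[OF \<phi> sm(1)] and \<phi>Z = test_function_vf_apply[OF \<phi> sm(2)]
  note int = integrable_locally_integrable_mult_test
  have loc: "locally_integrable UNIV u" "locally_integrable UNIV v'" "locally_integrable UNIV w'"
    using Yu ZYu YZu by (auto simp: has_weak_derivative_UNIV)
  have smphi: "smooth \<phi>" using \<phi> by (simp add: test_function_def)
  have "(\<integral>p. (w' p - v' p) * \<phi> p \<partial>lebesgue) = (\<integral>p. w' p * \<phi> p \<partial>lebesgue) - (\<integral>p. v' p * \<phi> p \<partial>lebesgue)"
    by (simp add: left_diff_distrib int[OF loc(2) \<phi>] int[OF loc(3) \<phi>])
  also have "\<dots> = (\<integral>p. v p * vf_apply Z \<phi> p \<partial>lebesgue) - (\<integral>p. w p * vf_apply Y \<phi> p \<partial>lebesgue)"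
    using ZYu YZu \<phi> by (simp add: has_weak_derivative_UNIV)
  also have "\<dots> = (\<integral>p. u p * vf_apply Z (vf_apply Y \<phi>) p \<partial>lebesgue)
      - (\<integral>p. u p * vf_apply Y (vf_apply Z \<phi>) p \<partial>lebesgue)"
    using Yu Zu \<phi>Y \<phi>Z by (simp add: has_weak_derivative_UNIV)
  also have "\<dots> = - (\<integral>p. u p * vf_apply (lie_bracket Y Z) \<phi> p \<partial>lebesgue)"
    by (simp add: vf_apply_lie_bracket[OF sm smphi] right_diff_distrib
        int[OF loc(1) test_function_vf_apply[OF \<phi>Y sm(2)]]
        int[OF loc(1) test_function_vf_apply[OF \<phi>Z sm(1)]])
  finally show "(\<integral>p. (w' p - v' p) * \<phi> p \<partial>lebesgue) =
      - (\<integral>p. u p * vf_apply (lie_bracket Y Z) \<phi> p \<partial>lebesgue)"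
    by simp
qed (use Yu locally_integrable_linear(1)[of UNIV v' w' "-1"] ZYu YZu
    in \<open>auto simp: has_weak_derivative_UNIV\<close>)


section \<open>The left-invariant frame and its grading\<close>

context graded_exp_coordinates
begin

lemma V_lie_algebra: "W \<in> V i \<Longrightarrow> i \<in> {1..s} \<Longrightarrow> W \<in> lie_algebra gmul"
  using V_subset by blast

lemma V_smooth: "W \<in> V i \<Longrightarrow> i \<in> {1..s} \<Longrightarrow> smooth W"
  using V_lie_algebra by (auto simp: lie_algebra_def)

lemma X_mem_V: "\<alpha> \<in> {1..n i} \<Longrightarrow> i \<in> {1..s} \<Longrightarrow> X i \<alpha> \<in> V i"
  using vf.span_base[OF imageI, of \<alpha> "{1..n i}" "X i"] X_span[of i] by simp

text \<open>
  A linear functional on \<open>V i\<close>. Unlike the structural constants it applies to brackets with arbitrary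
  fields of a layer, which keeps iterated brackets readable.
\<close>
definition coord :: "nat \<Rightarrow> nat \<Rightarrow> ('a \<Rightarrow> 'a) \<Rightarrow> real" where
  "coord i \<gamma> W = vf.representation (X i ` {1..n i}) W (X i \<gamma>)"

lemma coord_expansion:
  assumes "W \<in> V i" "i \<in> {1..s}"
  shows "W = (\<Sum>\<gamma>=1..n i. vf_scale (coord i \<gamma> W) (X i \<gamma>))"
proof -
  have "W = (\<Sum>Y\<in>X i ` {1..n i}. vf_scale (vf.representation (X i ` {1..n i}) W Y) Y)"
    using vf.sum_representation_eq[OF X_independent[OF assms(2)], of W "X i ` {1..n i}"]
      X_span[OF assms(2)] assms(1) by simp
  also have "\<dots> = (\<Sum>\<gamma>=1..n i. vf_scale (coord i \<gamma> W) (X i \<gamma>))"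
    by (subst sum.reindex[OF X_inj[OF assms(2)]]) (simp add: coord_def)
  finally show ?thesis .
qed

lemma V_sum:
  assumes "i \<in> {1..s}" and "\<And>j. j \<in> J \<Longrightarrow> W j \<in> V i"
  shows "(\<Sum>j\<in>J. vf_scale (r j) (W j)) \<in> V i"
  using assms by (intro vf.subspace_sum vf.subspace_scale V_subspace) auto

lemma coord_sum:
  assumes "i \<in> {1..s}" and "\<And>j. j \<in> J \<Longrightarrow> W j \<in> V i"
  shows "coord i \<gamma> (\<Sum>j\<in>J. vf_scale (r j) (W j)) = (\<Sum>j\<in>J. r j * coord i \<gamma> (W j))"
proof -
  note ind = X_independent[OF assms(1)] and sp = X_span[OF assms(1)]
  have "vf.representation (X i ` {1..n i}) (\<Sum>j\<in>J. vf_scale (r j) (W j)) =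
      (\<lambda>Y. \<Sum>j\<in>J. vf.representation (X i ` {1..n i}) (vf_scale (r j) (W j)) Y)"
    by (rule vf.representation_sum[OF ind]) (unfold sp, rule vf.subspace_scale[OF V_subspace[OF assms(1)] assms(2)])
  then show ?thesis
    unfolding coord_def
    by (simp add: vf.representation_scale[OF ind] sp assms(2) del: One_nat_def)
qed

lemma coord_basis:
  assumes "i \<in> {1..s}" "\<alpha> \<in> {1..n i}" "\<gamma> \<in> {1..n i}"
  shows "coord i \<gamma> (X i \<alpha>) = (if \<gamma> = \<alpha> then 1 else 0)"
  using vf.representation_basis[OF X_independent[OF assms(1)], of "X i \<alpha>"] assms(2,3)
    inj_on_eq_iff[OF X_inj[OF assms(1)], of \<gamma> \<alpha>]
  by (auto simp: coord_def)

lemma coord_linear_combination: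
  assumes "i \<in> {1..s}" "\<gamma> \<in> {1..n i}"
  shows "coord i \<gamma> (\<Sum>\<alpha>=1..n i. vf_scale (r \<alpha>) (X i \<alpha>)) = r \<gamma>"
proof -
  have "coord i \<gamma> (\<Sum>\<alpha>=1..n i. vf_scale (r \<alpha>) (X i \<alpha>)) = (\<Sum>\<alpha>=1..n i. r \<alpha> * coord i \<gamma> (X i \<alpha>))"
    by (rule coord_sum[OF assms(1)]) (rule X_mem_V[OF _ assms(1)])
  also have "\<dots> = (\<Sum>\<alpha>=1..n i. if \<alpha> = \<gamma> then r \<gamma> else 0)"
    by (intro sum.cong refl)
      (auto simp: coord_basis[OF assms(1) _ assms(2)] simp del: One_nat_def atLeastAtMost_iff)
  also have "\<dots> = r \<gamma>" using assms(2) by simp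
  finally show ?thesis .
qed

lemma coord_linear:
  assumes "i \<in> {1..s}" "W \<in> V i" "W' \<in> V i"
  shows "coord i \<gamma> (vf_scale r W + W') = r * coord i \<gamma> W + coord i \<gamma> W'"
proof -
  note ind = X_independent[OF assms(1)]
  have W: "W \<in> vf.span (X i ` {1..n i})" "W' \<in> vf.span (X i ` {1..n i})"
    unfolding X_span[OF assms(1)] by fact+
  show ?thesis
    unfolding coord_def vf.representation_add[OF ind W(2) vf.span_scale[OF W(1)]]
      vf.representation_scale[OF ind W(1)] ..
qed

lemma coord_diff:
  assumes "i \<in> {1..s}" "W \<in> V i" "W' \<in> V i"
  shows "coord i \<gamma> (W - W') = coord i \<gamma> W - coord i \<gamma> W'"
  using vf.representation_diff[OF X_independent[OF assms(1)], of W' W] X_span[OF assms(1)] assms(2,3)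
  by (simp add: coord_def)

text \<open>
  Left translation carries the value of the sum at \<open>p\<close> linearly to its value at any other point, so
  the sum is the zero field and its summands vanish because the sum of the layers is direct.
\<close>
lemma graded_components_zero:
  assumes W: "\<And>i. i \<in> {1..s} \<Longrightarrow> W i \<in> V i" and p: "(\<Sum>i=1..s. W i p) = 0" and i: "i \<in> {1..s}"
  shows "W i = 0"
proof -
  have "(\<Sum>i=1..s. W i) q = 0" for q
  proof -
    \<comment> \<open>Left translation by \<open>r\<close> takes \<open>p\<close> to \<open>q\<close>; \<open>D\<close> is its differential at \<open>p\<close>.\<close>
    define r where "r = gmul q (ginv p)"
    have q: "gmul r p = q" by (simp add: r_def assoc)
    have "((\<lambda>x. (r, x)) has_derivative (\<lambda>v. (0, v))) (at p)"
      by (intro has_derivative_Pair has_derivative_const has_derivative_ident)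
    from has_derivative_compose[OF this smooth_has_derivative[OF smooth_gmul]]
    obtain D where D: "(gmul r has_derivative D) (at p)" by auto
    have "W i q = D (W i p)" if "i \<in> {1..s}" for i
    proof -
      have "left_invariant gmul (W i)"
        using V_lie_algebra[OF W[OF that] that] by (simp add: lie_algebra_def)
      then show ?thesis unfolding left_invariant_def using q frechet_derivative_eqI[OF D] by metis
    qed
    then have "(\<Sum>i=1..s. W i) q = (\<Sum>i=1..s. D (W i p))" by (simp add: sum_fun_apply)
    also have "\<dots> = D (\<Sum>i=1..s. W i p)" by (simp add: linear_sum[OF has_derivative_linear[OF D]])
    also have "\<dots> = 0" by (simp add: p linear_0[OF has_derivative_linear[OF D]] del: One_nat_def)
    finally show ?thesis .
  qed
  then have S: "(\<Sum>i=1..s. W i) = 0" by (simp add: fun_eq_iff)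
  have zero: "0 \<in> lie_algebra gmul"
    using V_lie_algebra[of 0 1] vf.subspace_0[OF V_subspace[of 1]] step_pos by auto
  define v where "v = (\<lambda>i\<in>{1..s}. W i)"
  define z where "z = (\<lambda>i\<in>{1..s}. 0 :: 'a \<Rightarrow> 'a)"
  have "v \<in> Pi\<^sub>E {1..s} V" "0 = (\<Sum>i=1..s. v i)"
    using W S by (auto simp: v_def)
  moreover have "z \<in> Pi\<^sub>E {1..s} V" "0 = (\<Sum>i=1..s. z i)"
    using vf.subspace_0[OF V_subspace] by (auto simp: z_def)
  ultimately have "v = z" using direct_sum[OF zero] by blast
  then show ?thesis using i by (auto simp: v_def z_def fun_eq_iff split: if_splits)
qed

text \<open>
  On basis fields this is the existence of structural constants; bilinearity extends it, one
  argument at a time.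
\<close>
lemma bracket_mem:
  assumes c: "structural_constants s n X c" and ij: "1 \<le> i" "1 \<le> j" "i + j \<le> s"
    and A: "A \<in> V i" and B: "B \<in> V j"
  shows "lie_bracket A B \<in> V (i + j)"
proof -
  have i: "i \<in> {1..s}" and j: "j \<in> {1..s}" and k: "i + j \<in> {1..s}" using ij by auto
  have left: "lie_bracket A B \<in> V (i + j)"
    if "\<And>\<alpha>. \<alpha> \<in> {1..n l} \<Longrightarrow> lie_bracket (X l \<alpha>) B \<in> V (i + j)" "A \<in> V l" "l \<in> {1..s}" "smooth B" for A B l
  proof -
    have "lie_bracket A B = (\<Sum>\<alpha>=1..n l. vf_scale (coord l \<alpha> A) (lie_bracket (X l \<alpha>) B))"
      by (subst coord_expansion[OF that(2,3)])
        (rule lie_bracket_sum_left[OF V_smooth[OF X_mem_V[OF _ that(3)] that(3)] that(4)])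
    also have "\<dots> \<in> V (i + j)" by (rule V_sum[OF k that(1)])
    finally show ?thesis .
  qed
  have basis: "lie_bracket (X i \<alpha>) (X j \<beta>) \<in> V (i + j)" if "\<alpha> \<in> {1..n i}" "\<beta> \<in> {1..n j}" for \<alpha> \<beta>
  proof -
    have "lie_bracket (X i \<alpha>) (X j \<beta>) = (\<Sum>\<gamma>=1..n (i + j). vf_scale (c i j \<alpha> \<beta> \<gamma>) (X (i + j) \<gamma>))"
      using c ij that unfolding structural_constants_def by blast
    also have "\<dots> \<in> V (i + j)" by (rule V_sum[OF k X_mem_V[OF _ k]])
    finally show ?thesis .
  qed
  have swap: "lie_bracket Y Z \<in> V (i + j)" if "lie_bracket Z Y \<in> V (i + j)" for Y Z
    using vf.subspace_neg[OF V_subspace[OF k] that] lie_bracket_antisym[of Y Z] by simp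
  have "lie_bracket (X i \<alpha>) B \<in> V (i + j)" if \<alpha>: "\<alpha> \<in> {1..n i}" for \<alpha>
    by (rule swap, rule left[OF swap[OF basis[OF \<alpha>]] B j V_smooth[OF X_mem_V[OF \<alpha> i] i]])
  then show ?thesis by (rule left[OF _ A i V_smooth[OF B j]])
qed

lemma coord_lie_bracket:
  assumes c: "structural_constants s n X c" and ij: "1 \<le> i" "1 \<le> j" "i + j \<le> s"
    and A: "A \<in> V i" and B: "B \<in> V j"
  shows "coord (i + j) \<gamma> (lie_bracket A B) =
    (\<Sum>\<alpha>=1..n i. coord i \<alpha> A * coord (i + j) \<gamma> (lie_bracket (X i \<alpha>) B))"
proof -
  have i: "i \<in> {1..s}" and j: "j \<in> {1..s}" and k: "i + j \<in> {1..s}" using ij by auto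
  have "lie_bracket A B = (\<Sum>\<alpha>=1..n i. vf_scale (coord i \<alpha> A) (lie_bracket (X i \<alpha>) B))"
    by (subst coord_expansion[OF A i])
      (rule lie_bracket_sum_left[OF V_smooth[OF X_mem_V[OF _ i] i] V_smooth[OF B j]])
  moreover have "coord (i + j) \<gamma> (\<Sum>\<alpha>=1..n i. vf_scale (coord i \<alpha> A) (lie_bracket (X i \<alpha>) B)) =
      (\<Sum>\<alpha>=1..n i. coord i \<alpha> A * coord (i + j) \<gamma> (lie_bracket (X i \<alpha>) B))"
    by (rule coord_sum[OF k bracket_mem[OF c ij X_mem_V[OF _ i] B]])
  ultimately show ?thesis by (simp only:)
qed

lemma lie_bracket_V_last:
  assumes "Z \<in> V 1" "W \<in> V s"
  shows "lie_bracket W Z = 0"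
proof -
  have "lie_bracket Z W \<in> bracket_space (V 1) (V s)"
    unfolding bracket_space_def by (rule vf.span_base) (use assms in blast)
  then have "lie_bracket Z W = 0" using V_last by simp
  then show ?thesis using lie_bracket_antisym[of W Z] by simp
qed

end


section \<open>Fields whose bracket with \<open>b\<close> respects the filtration\<close>

text \<open>
  Bracketing with a field in \<open>V 1\<close> raises the degree by one and kills the last layer, so the layers
  of \<open>[b, Z]\<close> are indexed with a shift.
\<close>
lemma sum_shift_by_one:
  fixes g :: "nat \<Rightarrow> 'b::comm_monoid_add"
  assumes "1 \<le> s" and "g s = 0"
  shows "(\<Sum>k=1..s. if k = 1 then a else g (k - 1)) = a + (\<Sum>i=1..s. g i)"
proof -
  obtain t where t: "s = Suc t" using assms(1) by (cases s) auto
  have "(\<Sum>k=1..s. if k = 1 then a else g (k - 1)) = a + (\<Sum>k=Suc 1..Suc t. if k = 1 then a else g (k - 1))"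
    by (subst sum.atLeast_Suc_atMost) (use assms t in auto)
  also have "(\<Sum>k=Suc 1..Suc t. if k = 1 then a else g (k - 1)) = (\<Sum>i=1..t. g i)"
    by (subst sum.atLeast_Suc_atMost_Suc_shift) (intro sum.cong refl, auto)
  also have "\<dots> = (\<Sum>i=1..s. g i)" using assms(2) by (simp add: t)
  finally show ?thesis .
qed

context graded_exp_coordinates
begin

text \<open>
  Meant for \<open>Y \<in> V j\<close>. It then expresses that the components of \<open>[b, Y]\<close> in the layers above \<open>j\<close>
  vanish in the weak sense.
\<close>
definition bracket_filtered :: "(nat \<Rightarrow> nat \<Rightarrow> 'a \<Rightarrow> real) \<Rightarrow> nat \<Rightarrow> ('a \<Rightarrow> 'a) \<Rightarrow> bool" where
  "bracket_filtered b j Y \<longleftrightarrow> (\<forall>k\<in>{j + 1..s}. \<forall>\<gamma>\<in>{1..n k}.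
     has_weak_derivative UNIV Y (b k \<gamma>)
       (\<lambda>p. \<Sum>\<alpha>=1..n (k - j). coord k \<gamma> (lie_bracket (X (k - j) \<alpha>) Y) * b (k - j) \<alpha> p))"

text \<open>
  The algebra at a single point: \<open>u\<close> and \<open>w\<close> stand for the values at \<open>p\<close> of the coefficients of \<open>b\<close> and
  of their derivatives along \<open>Z\<close>. With these values frozen, \<open>[b, Z]\<close> becomes a left-invariant field,
  and its components can be compared with those of a horizontal field.
\<close>
lemma vertical_coefficients:
  assumes c: "structural_constants s n X c" and Z: "Z \<in> V 1"
    and hor: "(\<Sum>i=1..s. \<Sum>\<alpha>=1..n i. u i \<alpha> *\<^sub>R lie_bracket (X i \<alpha>) Z p)
               - (\<Sum>i=1..s. \<Sum>\<alpha>=1..n i. w i \<alpha> *\<^sub>R X i \<alpha> p) \<in> horizontal V p"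
    and k: "k \<in> {2..s}" and \<gamma>: "\<gamma> \<in> {1..n k}"
  shows "w k \<gamma> = (\<Sum>\<alpha>=1..n (k - 1). coord k \<gamma> (lie_bracket (X (k - 1) \<alpha>) Z) * u (k - 1) \<alpha>)"
proof -
  \<comment> \<open>\<open>g i\<close> lies in layer \<open>i + 1\<close>, \<open>h i\<close> in layer \<open>i\<close>.\<close>
  define g where "g = (\<lambda>i. \<Sum>\<alpha>=1..n i. vf_scale (u i \<alpha>) (lie_bracket (X i \<alpha>) Z))"
  define h where "h = (\<lambda>i. \<Sum>\<alpha>=1..n i. vf_scale (w i \<alpha>) (X i \<alpha>))"
  obtain Z' where Z': "Z' \<in> V 1" and hor': "(\<Sum>i=1..s. g i p) - (\<Sum>i=1..s. h i p) = Z' p"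
    using hor by (auto simp: horizontal_def g_def h_def sum_fun_apply vf_scale_def)
  have gV: "g i \<in> V (Suc i)" if i: "i \<in> {1..<s}" for i
    unfolding g_def
  proof (rule V_sum)
    fix \<alpha> assume "\<alpha> \<in> {1..n i}"
    then show "lie_bracket (X i \<alpha>) Z \<in> V (Suc i)"
      using bracket_mem[OF c _ _ _ X_mem_V Z, of i \<alpha>] i by simp
  qed (use i in auto)
  have gs: "g s = 0"
    using lie_bracket_V_last[OF Z X_mem_V] step_pos unfolding g_def by (intro sum.neutral) auto
  have hV: "h i \<in> V i" if "i \<in> {1..s}" for i
    unfolding h_def by (rule V_sum[OF that X_mem_V[OF _ that]])
  define W where "W = (\<lambda>i. (if i = 1 then - Z' else g (i - 1)) - h i)"
  have W: "W i \<in> V i" if i: "i \<in> {1..s}" for i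
  proof -
    have "(if i = 1 then - Z' else g (i - 1)) \<in> V i"
    proof (cases "i = 1")
      case True
      then show ?thesis using vf.subspace_neg[OF V_subspace[OF i], of Z'] Z' by simp
    next
      case False
      then have "i - 1 \<in> {1..<s}" "Suc (i - 1) = i" using i by auto
      then show ?thesis using gV[of "i - 1"] False by (simp only: if_False)
    qed
    then show ?thesis unfolding W_def by (rule vf.subspace_diff[OF V_subspace[OF i] _ hV[OF i]])
  qed
  have "(\<Sum>i=1..s. W i p) = (\<Sum>i=1..s. if i = 1 then - Z' p else g (i - 1) p) - (\<Sum>i=1..s. h i p)"
    unfolding W_def sum_subtractf[symmetric] by (intro sum.cong refl) auto
  also have "\<dots> = 0"
    using sum_shift_by_one[OF step_pos, of "\<lambda>i. g i p" "- Z' p"] gs hor' by (simp add: algebra_simps)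
  finally have Wp: "(\<Sum>i=1..s. W i p) = 0" .
  have "k \<in> {1..s}" using k by auto
  from graded_components_zero[OF W Wp this] have "W k = 0" .
  then have "h k = g (k - 1)" using k by (auto simp: W_def)
  then have "w k \<gamma> = coord k \<gamma> (g (k - 1))"
    using coord_linear_combination[OF \<open>k \<in> {1..s}\<close> \<gamma>, of "w k"] by (simp only: h_def)
  also have "\<dots> = (\<Sum>\<alpha>=1..n (k - 1). u (k - 1) \<alpha> * coord k \<gamma> (lie_bracket (X (k - 1) \<alpha>) Z))"
    unfolding g_def
  proof (rule coord_sum[OF \<open>k \<in> {1..s}\<close>])
    fix \<alpha> assume \<alpha>: "\<alpha> \<in> {1..n (k - 1)}"
    have ar: "1 \<le> k - 1" "(1::nat) \<le> 1" "k - 1 + 1 \<le> s" "k - 1 + 1 = k" "k - 1 \<in> {1..s}"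
      using k by auto
    then show "lie_bracket (X (k - 1) \<alpha>) Z \<in> V k"
      using bracket_mem[OF c ar(1-3) X_mem_V[OF \<alpha> ar(5)] Z] by (simp only: ar(4))
  qed
  finally show ?thesis by (simp only: mult.commute)
qed

text \<open>
  The pointwise comparison holds almost everywhere, which is enough because a weak derivative may be
  changed on a null set.
\<close>
lemma bracket_filtered_horizontal:
  assumes c: "structural_constants s n X c" and Z: "Z \<in> V 1"
    and B: "is_weak_bracket s n X b Z B" and hor: "AE p in lebesgue. B p \<in> horizontal V p"
  shows "bracket_filtered b 1 Z"
  unfolding bracket_filtered_def
proof (intro ballI)
  fix k \<gamma> assume k: "k \<in> {1 + 1..s}" and \<gamma>: "\<gamma> \<in> {1..n k}"
  obtain Zb where Zb: "\<And>i \<alpha>. i \<in> {1..s} \<Longrightarrow> \<alpha> \<in> {1..n i} \<Longrightarrow> has_weak_derivative UNIV Z (b i \<alpha>) (Zb i \<alpha>)"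
    and B': "B = (\<lambda>p. (\<Sum>i=1..s. \<Sum>\<alpha>=1..n i. b i \<alpha> p *\<^sub>R lie_bracket (X i \<alpha>) Z p)
               - (\<Sum>i=1..s. \<Sum>\<alpha>=1..n i. Zb i \<alpha> p *\<^sub>R X i \<alpha> p))"
    using B unfolding is_weak_bracket_def by blast
  have k': "k \<in> {2..s}" "k \<in> {1..s}" "k - 1 \<in> {1..s}" using k by auto
  have "(1::nat) \<in> {1..s}" using step_pos by simp
  note Zsm = V_smooth[OF Z this]
  show "has_weak_derivative UNIV Z (b k \<gamma>)
     (\<lambda>p. \<Sum>\<alpha>=1..n (k - 1). coord k \<gamma> (lie_bracket (X (k - 1) \<alpha>) Z) * b (k - 1) \<alpha> p)"
  proof (rule has_weak_derivative_AE_cong[OF Zb[OF k'(2) \<gamma>]])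
    show "locally_integrable UNIV
        (\<lambda>p. \<Sum>\<alpha>=1..n (k - 1). coord k \<gamma> (lie_bracket (X (k - 1) \<alpha>) Z) * b (k - 1) \<alpha> p)"
    proof -
      \<comment> \<open>Having a weak derivative includes local integrability.\<close>
      have "has_weak_derivative UNIV Z
        (\<lambda>p. \<Sum>\<alpha>=1..n (k - 1). coord k \<gamma> (lie_bracket (X (k - 1) \<alpha>) Z) * b (k - 1) \<alpha> p)
        (\<lambda>p. \<Sum>\<alpha>=1..n (k - 1). coord k \<gamma> (lie_bracket (X (k - 1) \<alpha>) Z) * Zb (k - 1) \<alpha> p)"
        by (rule has_weak_derivative_sum[OF Zsm Zb[OF k'(3)]])
      then show ?thesis unfolding has_weak_derivative_UNIV by (rule conjunct1)
    qed
    show "AE p in lebesgue. Zb k \<gamma> p =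
        (\<Sum>\<alpha>=1..n (k - 1). coord k \<gamma> (lie_bracket (X (k - 1) \<alpha>) Z) * b (k - 1) \<alpha> p)"
      using hor by eventually_elim (rule vertical_coefficients[OF c Z _ k'(1) \<gamma>], simp only: B')
  qed
qed

lemma bracket_filtered_zero:
  assumes j: "1 \<le> j" and loc: "\<And>k \<gamma>. k \<in> {1..s} \<Longrightarrow> \<gamma> \<in> {1..n k} \<Longrightarrow> locally_integrable UNIV (b k \<gamma>)"
  shows "bracket_filtered b j 0"
  unfolding bracket_filtered_def
proof (intro ballI)
  fix k \<gamma> assume k: "k \<in> {j + 1..s}" and \<gamma>: "\<gamma> \<in> {1..n k}"
  then have ks: "k \<in> {1..s}" "k - j \<in> {1..s}" using j by auto
  have "coord k \<gamma> (lie_bracket (X (k - j) \<alpha>) 0) * b (k - j) \<alpha> p = 0" if "\<alpha> \<in> {1..n (k - j)}" for \<alpha> p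
    using lie_bracket_antisym[of "X (k - j) \<alpha>" 0]
      lie_bracket_zero_left[OF V_smooth[OF X_mem_V[OF that ks(2)] ks(2)]]
    by (simp add: coord_def vf.representation_zero)
  then have "(\<Sum>\<alpha>=1..n (k - j). coord k \<gamma> (lie_bracket (X (k - j) \<alpha>) 0) * b (k - j) \<alpha> p) = 0" for p
    by (intro sum.neutral ballI)
  then show "has_weak_derivative UNIV 0 (b k \<gamma>)
      (\<lambda>p. \<Sum>\<alpha>=1..n (k - j). coord k \<gamma> (lie_bracket (X (k - j) \<alpha>) 0) * b (k - j) \<alpha> p)"
    using has_weak_derivative_zero_field[OF loc[OF ks(1) \<gamma>]] by (simp only:)
qed

lemma bracket_filtered_linear:
  assumes c: "structural_constants s n X c" and j: "1 \<le> j" "j \<le> s"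
    and Y: "Y \<in> V j" and Z: "Z \<in> V j" and DY: "bracket_filtered b j Y" and DZ: "bracket_filtered b j Z"
  shows "bracket_filtered b j (vf_scale r Y + Z)"
  unfolding bracket_filtered_def
proof (intro ballI)
  fix k \<gamma> assume k: "k \<in> {j + 1..s}" and \<gamma>: "\<gamma> \<in> {1..n k}"
  then have ks: "k \<in> {1..s}" "k - j \<in> {1..s}" "j \<in> {1..s}" "1 \<le> k - j" "k - j + j \<le> s" "k - j + j = k"
    using j by auto
  note sm = V_smooth[OF Y ks(3)] V_smooth[OF Z ks(3)]
  have "coord k \<gamma> (lie_bracket (X (k - j) \<alpha>) (vf_scale r Y + Z)) =
      r * coord k \<gamma> (lie_bracket (X (k - j) \<alpha>) Y) + coord k \<gamma> (lie_bracket (X (k - j) \<alpha>) Z)"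
    if \<alpha>: "\<alpha> \<in> {1..n (k - j)}" for \<alpha>
  proof -
    note X = X_mem_V[OF \<alpha> ks(2)]
    show ?thesis
      unfolding lie_bracket_linear_right[OF V_smooth[OF X ks(2)] sm]
      using bracket_mem[OF c ks(4) j(1) ks(5) X Y] bracket_mem[OF c ks(4) j(1) ks(5) X Z]
      unfolding ks(6) by (rule coord_linear[OF ks(1)])
  qed
  then have "(\<Sum>\<alpha>=1..n (k - j). coord k \<gamma> (lie_bracket (X (k - j) \<alpha>) (vf_scale r Y + Z)) * b (k - j) \<alpha> p) =
      r * (\<Sum>\<alpha>=1..n (k - j). coord k \<gamma> (lie_bracket (X (k - j) \<alpha>) Y) * b (k - j) \<alpha> p)
      + (\<Sum>\<alpha>=1..n (k - j). coord k \<gamma> (lie_bracket (X (k - j) \<alpha>) Z) * b (k - j) \<alpha> p)" for p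
    unfolding sum_distrib_left sum.distrib[symmetric]
    by (intro sum.cong refl) (simp add: algebra_simps)
  then show "has_weak_derivative UNIV (vf_scale r Y + Z) (b k \<gamma>)
      (\<lambda>p. \<Sum>\<alpha>=1..n (k - j). coord k \<gamma> (lie_bracket (X (k - j) \<alpha>) (vf_scale r Y + Z)) * b (k - j) \<alpha> p)"
    using has_weak_derivative_linear_field[OF sm
        DY[unfolded bracket_filtered_def, rule_format, OF k \<gamma>]
        DZ[unfolded bracket_filtered_def, rule_format, OF k \<gamma>], of r] by simp
qed

text \<open>
  Differentiating the sum term by term along \<open>A\<close> produces a product of two matrices of structural
  coefficients; it is the matrix of first bracketing with \<open>A\<close> and then with \<open>B\<close>.
\<close>
lemma bracket_filtered_twice:
  assumes c: "structural_constants s n X c" and ij: "1 \<le> i" "1 \<le> j"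
    and A: "A \<in> V i" and B: "B \<in> V j" and DA: "bracket_filtered b i A"
    and m: "1 \<le> m" "m + i + j \<le> s"
  shows "has_weak_derivative UNIV A
    (\<lambda>p. \<Sum>\<alpha>=1..n (m + i). coord (m + i + j) \<gamma> (lie_bracket (X (m + i) \<alpha>) B) * b (m + i) \<alpha> p)
    (\<lambda>p. \<Sum>\<delta>=1..n m. coord (m + i + j) \<gamma> (lie_bracket (lie_bracket (X m \<delta>) A) B) * b m \<delta> p)"
proof -
  have idx: "i \<in> {1..s}" "m \<in> {1..s}" using ij m by auto
  have "has_weak_derivative UNIV A
    (\<lambda>p. \<Sum>\<alpha>=1..n (m + i). coord (m + i + j) \<gamma> (lie_bracket (X (m + i) \<alpha>) B) * b (m + i) \<alpha> p)
    (\<lambda>p. \<Sum>\<alpha>=1..n (m + i). coord (m + i + j) \<gamma> (lie_bracket (X (m + i) \<alpha>) B) *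
       (\<Sum>\<delta>=1..n m. coord (m + i) \<alpha> (lie_bracket (X m \<delta>) A) * b m \<delta> p))"
  proof (rule has_weak_derivative_sum[OF V_smooth[OF A idx(1)]])
    fix \<alpha> assume \<alpha>: "\<alpha> \<in> {1..n (m + i)}"
    have "m + i \<in> {i + 1..s}" using m by auto
    from DA[unfolded bracket_filtered_def, rule_format, OF this \<alpha>]
    show "has_weak_derivative UNIV A (b (m + i) \<alpha>)
        (\<lambda>p. \<Sum>\<delta>=1..n m. coord (m + i) \<alpha> (lie_bracket (X m \<delta>) A) * b m \<delta> p)"
      by simp
  qed
  moreover have "(\<Sum>\<alpha>=1..n (m + i). coord (m + i + j) \<gamma> (lie_bracket (X (m + i) \<alpha>) B) *
       (\<Sum>\<delta>=1..n m. coord (m + i) \<alpha> (lie_bracket (X m \<delta>) A) * b m \<delta> p)) =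
     (\<Sum>\<delta>=1..n m. coord (m + i + j) \<gamma> (lie_bracket (lie_bracket (X m \<delta>) A) B) * b m \<delta> p)" for p
  proof -
    have "coord (m + i + j) \<gamma> (lie_bracket (lie_bracket (X m \<delta>) A) B) =
       (\<Sum>\<alpha>=1..n (m + i). coord (m + i) \<alpha> (lie_bracket (X m \<delta>) A) *
           coord (m + i + j) \<gamma> (lie_bracket (X (m + i) \<alpha>) B))" if "\<delta> \<in> {1..n m}" for \<delta>
      by (rule coord_lie_bracket[OF c _ ij(2) m(2) bracket_mem[OF c m(1) ij(1) _ X_mem_V[OF that idx(2)] A] B])
        (use m in auto)
    then show ?thesis
      by (simp add: sum_distrib_left sum_distrib_right mult.left_commute mult.assoc del: One_nat_def)
        (subst sum.swap, simp add: mult.left_commute)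
  qed
  ultimately show ?thesis by simp
qed

text \<open>
  The derivatives of \<open>b k \<gamma>\<close> along \<open>A\<close> and \<open>B\<close> in either order have the coefficients of
  \<open>[[X, B], A]\<close> and \<open>[[X, A], B]\<close>; by the Jacobi identity their difference has those of
  \<open>[X, [A, B]]\<close>.
\<close>
lemma bracket_filtered_lie_bracket:
  assumes c: "structural_constants s n X c" and ij: "1 \<le> i" "1 \<le> j" "i + j \<le> s"
    and A: "A \<in> V i" and B: "B \<in> V j" and DA: "bracket_filtered b i A" and DB: "bracket_filtered b j B"
  shows "bracket_filtered b (i + j) (lie_bracket A B)"
  unfolding bracket_filtered_def
proof (intro ballI)
  fix k \<gamma> assume k: "k \<in> {i + j + 1..s}" and \<gamma>: "\<gamma> \<in> {1..n k}"
  define m where "m = k - (i + j)"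
  have m: "1 \<le> m" "m + i + j \<le> s" "m + j + i \<le> s" using k by (auto simp: m_def)
  have idx: "i \<in> {1..s}" "j \<in> {1..s}" "m \<in> {1..s}" "k \<in> {1..s}" using ij m k by auto
  have k': "k \<in> {i + 1..s}" "k \<in> {j + 1..s}" "k - i = m + j" "k - j = m + i" "m + j + i = k" "m + i + j = k"
    using k m_def by auto
  note smA = V_smooth[OF A idx(1)] and smB = V_smooth[OF B idx(2)]
  have "has_weak_derivative UNIV (lie_bracket A B) (b k \<gamma>)
    (\<lambda>p. (\<Sum>\<delta>=1..n m. coord k \<gamma> (lie_bracket (lie_bracket (X m \<delta>) A) B) * b m \<delta> p)
       - (\<Sum>\<delta>=1..n m. coord k \<gamma> (lie_bracket (lie_bracket (X m \<delta>) B) A) * b m \<delta> p))"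
    using DA[unfolded bracket_filtered_def, rule_format, OF k'(1) \<gamma>]
      DB[unfolded bracket_filtered_def, rule_format, OF k'(2) \<gamma>]
      bracket_filtered_twice[OF c ij(2,1) B A DB m(1,3), of \<gamma>]
      bracket_filtered_twice[OF c ij(1,2) A B DA m(1,2), of \<gamma>]
    unfolding k'(3-6) by (rule has_weak_derivative_lie_bracket[OF smA smB])
  moreover have "(\<Sum>\<delta>=1..n m. coord k \<gamma> (lie_bracket (lie_bracket (X m \<delta>) A) B) * b m \<delta> p)
       - (\<Sum>\<delta>=1..n m. coord k \<gamma> (lie_bracket (lie_bracket (X m \<delta>) B) A) * b m \<delta> p)
      = (\<Sum>\<delta>=1..n m. coord k \<gamma> (lie_bracket (X m \<delta>) (lie_bracket A B)) * b m \<delta> p)" for p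
    unfolding sum_subtractf[symmetric] left_diff_distrib[symmetric]
  proof (intro sum.cong refl arg_cong2[where f = "(*)"])
    fix \<delta> assume \<delta>: "\<delta> \<in> {1..n m}"
    note Xm = X_mem_V[OF \<delta> idx(3)]
    have "lie_bracket (X m \<delta>) A \<in> V (m + i)" "lie_bracket (X m \<delta>) B \<in> V (m + j)"
      using bracket_mem[OF c m(1) ij(1) _ Xm A] bracket_mem[OF c m(1) ij(2) _ Xm B] m by auto
    then have "lie_bracket (lie_bracket (X m \<delta>) A) B \<in> V k" "lie_bracket (lie_bracket (X m \<delta>) B) A \<in> V k"
      using bracket_mem[OF c _ ij(2) m(2) _ B] bracket_mem[OF c _ ij(1) m(3) _ A] m k' by auto
    then show "coord k \<gamma> (lie_bracket (lie_bracket (X m \<delta>) A) B) - coord k \<gamma> (lie_bracket (lie_bracket (X m \<delta>) B) A)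
      = coord k \<gamma> (lie_bracket (X m \<delta>) (lie_bracket A B))"
      by (simp only: lie_bracket_Jacobi[OF V_smooth[OF Xm idx(3)] smA smB] coord_diff[OF idx(4)])
  qed
  ultimately show "has_weak_derivative UNIV (lie_bracket A B) (b k \<gamma>)
     (\<lambda>p. \<Sum>\<alpha>=1..n (k - (i + j)). coord k \<gamma> (lie_bracket (X (k - (i + j)) \<alpha>) (lie_bracket A B)) * b (k - (i + j)) \<alpha> p)"
    unfolding m_def[symmetric] by (simp only:)
qed

text \<open>
  Since \<open>V (j + 1)\<close> is spanned by brackets of \<open>V 1\<close> with \<open>V j\<close>, closure under brackets and linear
  combinations propagates the property from \<open>V 1\<close> through all layers.
\<close>
lemma bracket_filtered_all:
  assumes c: "structural_constants s n X c"
    and loc: "\<And>k \<gamma>. k \<in> {1..s} \<Longrightarrow> \<gamma> \<in> {1..n k} \<Longrightarrow> locally_integrable UNIV (b k \<gamma>)"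
    and D1: "\<And>Z. Z \<in> V 1 \<Longrightarrow> bracket_filtered b 1 Z"
    and j: "1 \<le> j" "j \<le> s" and Y: "Y \<in> V j"
  shows "bracket_filtered b j Y"
  using j Y
proof (induction j arbitrary: Y rule: nat_induct_at_least)
  case base
  then show ?case using D1 by simp
next
  case (Suc j)
  have j: "j \<in> {1..<s}" "Suc j \<in> {1..s}" "1 \<le> Suc j" using Suc.hyps Suc.prems by auto
  have "Y \<in> vf.span {lie_bracket A Z | A Z. A \<in> V 1 \<and> Z \<in> V j}"
    using V_generated[OF j(1)] Suc.prems(2) by (simp add: bracket_space_def)
  then have "Y \<in> V (Suc j) \<and> bracket_filtered b (Suc j) Y"
  proof (induction rule: vf.span_induct_alt)
    case base
    show ?case using vf.subspace_0[OF V_subspace[OF j(2)]] bracket_filtered_zero[OF j(3), of b] loc by blast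
  next
    case (step r W Z)
    obtain A U where W: "W = lie_bracket A U" and A: "A \<in> V 1" and U: "U \<in> V j" using step.hyps by blast
    have le: "(1::nat) \<le> 1" "1 \<le> j" "1 + j \<le> s" "j \<le> s" using j by auto
    have "W \<in> V (Suc j)" "bracket_filtered b (Suc j) W"
      using bracket_mem[OF c le(1-3) A U]
        bracket_filtered_lie_bracket[OF c le(1-3) A U D1[OF A] Suc.IH[OF le(4) U]] W by simp_all
    moreover have "Z \<in> V (Suc j)" "bracket_filtered b (Suc j) Z" using step.IH by blast+
    ultimately show ?case
      using bracket_filtered_linear[OF c j(3) Suc.prems(1)]
        vf.subspace_add[OF V_subspace[OF j(2)] vf.subspace_scale[OF V_subspace[OF j(2)]]] by blast
  qed
  then show ?case by blast
qed

end

theorem proposition4p2: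
  fixes gmul :: "'a::euclidean_space \<Rightarrow> 'a \<Rightarrow> 'a" and gid :: 'a and ginv :: "'a \<Rightarrow> 'a"
    and s :: nat and V :: "nat \<Rightarrow> ('a \<Rightarrow> 'a) set"
    and n :: "nat \<Rightarrow> nat" and X :: "nat \<Rightarrow> nat \<Rightarrow> 'a \<Rightarrow> 'a" and e :: "nat \<Rightarrow> nat \<Rightarrow> 'a"
    and c :: "nat \<Rightarrow> nat \<Rightarrow> nat \<Rightarrow> nat \<Rightarrow> nat \<Rightarrow> real"
    and \<theta> :: ennreal and b :: "nat \<Rightarrow> nat \<Rightarrow> 'a \<Rightarrow> real"
  assumes "graded_exp_coordinates gmul gid ginv s V n X e"
    and "structural_constants s n X c"
    and "1 \<le> \<theta>"
    and "\<forall>i\<in>{1..s}. \<forall>\<alpha>\<in>{1..n i}. in_W1H_loc n X \<theta> UNIV (b i \<alpha>)"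
    and "\<forall>Z\<in>V 1. \<exists>B. is_weak_bracket s n X b Z B \<and> (AE p in lebesgue. B p \<in> horizontal V p)"
  shows "\<forall>j\<in>{1..s - 1}. \<forall>\<beta>\<in>{1..n j}. \<forall>k\<in>{j + 1..s}. \<forall>\<gamma>\<in>{1..n k}.
    has_weak_derivative UNIV (X j \<beta>) (b k \<gamma>)
      (\<lambda>p. \<Sum>\<alpha>=1..n (k - j). c (k - j) j \<alpha> \<beta> \<gamma> * b (k - j) \<alpha> p)"
proof (intro ballI)
  interpret graded_exp_coordinates gmul gid ginv s V n X e by (rule assms(1))
  fix j \<beta> k \<gamma>
  assume j: "j \<in> {1..s - 1}" and \<beta>: "\<beta> \<in> {1..n j}" and k: "k \<in> {j + 1..s}" and \<gamma>: "\<gamma> \<in> {1..n k}"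
  have D1: "bracket_filtered b 1 Z" if "Z \<in> V 1" for Z
    using assms(5) that bracket_filtered_horizontal[OF assms(2) that] by blast
  \<comment> \<open>Any field of \<open>V 1\<close> would do: the coefficients of \<open>b\<close> have a weak derivative along it.\<close>
  have "0 \<in> V 1" using vf.subspace_0[OF V_subspace[of 1]] step_pos by simp
  then have loc: "locally_integrable UNIV (b i \<alpha>)" if "i \<in> {1..s}" "\<alpha> \<in> {1..n i}" for i \<alpha>
    using assms(5) that unfolding is_weak_bracket_def has_weak_derivative_UNIV by blast
  have js: "1 \<le> j" "j \<le> s" "j \<in> {1..s}" "k \<in> {1..s}" "1 \<le> k - j" "k - j + j \<le> s" "k - j + j = k"
    using j k by auto
  have "bracket_filtered b j (X j \<beta>)"
    by (rule bracket_filtered_all[OF assms(2) loc D1 js(1,2) X_mem_V[OF \<beta> js(3)]])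
  then have "has_weak_derivative UNIV (X j \<beta>) (b k \<gamma>)
       (\<lambda>p. \<Sum>\<alpha>=1..n (k - j). coord k \<gamma> (lie_bracket (X (k - j) \<alpha>) (X j \<beta>)) * b (k - j) \<alpha> p)"
    using k \<gamma> unfolding bracket_filtered_def by blast
  moreover have "(\<Sum>\<alpha>=1..n (k - j). coord k \<gamma> (lie_bracket (X (k - j) \<alpha>) (X j \<beta>)) * b (k - j) \<alpha> p)
      = (\<Sum>\<alpha>=1..n (k - j). c (k - j) j \<alpha> \<beta> \<gamma> * b (k - j) \<alpha> p)" for p
  proof (intro sum.cong refl arg_cong2[where f = "(*)"])
    fix \<alpha> assume \<alpha>: "\<alpha> \<in> {1..n (k - j)}"
    have "lie_bracket (X (k - j) \<alpha>) (X j \<beta>) = (\<Sum>\<gamma>=1..n k. vf_scale (c (k - j) j \<alpha> \<beta> \<gamma>) (X k \<gamma>))"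
      using assms(2)[unfolded structural_constants_def, rule_format, OF js(5,1,6) \<alpha> \<beta>] by (simp only: js(7))
    then show "coord k \<gamma> (lie_bracket (X (k - j) \<alpha>) (X j \<beta>)) = c (k - j) j \<alpha> \<beta> \<gamma>"
      by (simp only: coord_linear_combination[OF js(4) \<gamma>])
  qed
  ultimately show "has_weak_derivative UNIV (X j \<beta>) (b k \<gamma>)
      (\<lambda>p. \<Sum>\<alpha>=1..n (k - j). c (k - j) j \<alpha> \<beta> \<gamma> * b (k - j) \<alpha> p)"
    by (simp only:)
qed

end
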